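(* Let $n=3$ and let $a_0,b_0,c_0,d_0$ be real with $a_0d_0-b_0c_0\ne0$. In the weighted polynomial regression with basis $(1,x,x^2)^\top$ and variance function $\sigma_P^2(x;a_0,b_0,c_0,d_0)$, the three-point tube-volume optimal designs are precisely the designs with points $x_i$ and weights $p_i$, $i=1,2,3$, given by $$x_i=\varphi^{-1}(\tan(\pi t_i^0);a,b,c,d),\qquad p_i=k\,\frac{\sigma_P^2(x_i;a_0,b_0,c_0,d_0)}{\sigma_P^2(x_i;a,b,c,d)},$$ where $(t^0_1,t^0_2,t^0_3)=(-\tfrac13,0,\tfrac13)$, $a,b,c,d$ are arbitrary real numbers with $ad-bc\neq0$, and $k>0$ is the constant such that $\sum_ip_i=1$. This family includes the (three-point) D-optimal designs, as the special cases where $$\varphi(\cdot;a,b,c,d)=\varphi(\cdot;s,-t,t,s)\circ\varphi(\cdot;a_0,b_0,c_0,d_0)$$ holds for some real $s,t$ with $s^2+t^2=1$.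
   Context: Let $f_P(x)=(1,x,x^2)^\top$ and $g_P=f_P'$. For $ad-bc\neq 0$, $\varphi(x;a,b,c,d)=\frac{ax+b}{cx+d}$ is the real Möbius transformation on $\mathbb{R}\cup\{\pm\infty\}$ (with $+\infty$ and $-\infty$ identified), with $\pm\infty\mapsto a/c$, $-d/c\mapsto\pm\infty$, and $\varphi^{-1}(\cdot;a,b,c,d)=\varphi(\cdot;d,-b,-c,a)$. Variance functions (for $n=3$): $\sigma_P^2(x;a,b,c,d)=\{(b^2+d^2)+2(ab+cd)x+(a^2+c^2)x^2\}^{2}$. A design consists of points $x_i\in\mathbb{R}\cup\{\pm\infty\}$ with weights $p_i>0$, $\sum_ip_i=1$. Its information matrix under variance function $\sigma^2$ is $M=\sum_ip_if_P(x_i)f_P(x_i)^\top/\sigma^2(x_i)$. Expressions at a point $\pm\infty$ (here and in the formula for $p_i$) are understood as limits $x\to\pm\infty$. For positive definite $\Sigma$ let $$\mathrm{Vol}_1(\gamma_\Sigma)=2\int_{-\infty}^{\infty}\frac{\sqrt{(f_P^\top\Sigma f_P)(g_P^\top\Sigma g_P)-(f_P^\top\Sigma g_P)^2}}{f_P^\top\Sigma f_P}\,dx .$$ A design is tube-volume optimal if its information matrix $M$ is nonsingular and $\mathrm{Vol}_1(\gamma_{M^{-1}})$ is minimal among the nonsingular information matrices of all designs (equivalently, among all positive definite matrices $\int_{\mathbb{R}} f_Pf_P^\top d\rho$ with $\rho$ a nonnegative finite measure on $\mathbb{R}$). A design is D-optimal if it maximizes $\det M$ among all designs. *)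

theory Defs
  imports "HOL-Analysis.Analysis"
begin

text \<open>The extended real line with \<open>+\<infinity>\<close> and \<open>-\<infinity>\<close> identified.\<close>

datatype rproj = Fin real | Infty

text \<open>For \<open>c = 0\<close> the value \<open>a/c\<close> at infinity is again the point at infinity.\<close>

fun mobius :: "real \<Rightarrow> real \<Rightarrow> real \<Rightarrow> real \<Rightarrow> rproj \<Rightarrow> rproj" where
  "mobius a b c d (Fin x) = (if c * x + d = 0 then Infty else Fin ((a * x + b) / (c * x + d)))"
| "mobius a b c d Infty = (if c = 0 then Infty else Fin (a / c))"

definition mobius_inv :: "real \<Rightarrow> real \<Rightarrow> real \<Rightarrow> real \<Rightarrow> rproj \<Rightarrow> rproj" where
  "mobius_inv a b c d = mobius d (- b) (- c) a"

lemma mobius_inv_mobius: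
  assumes "a * d - b * c \<noteq> 0"
  shows "mobius_inv a b c d (mobius a b c d y) = y"
proof (cases y)
  case (Fin x)
  show ?thesis
  proof (cases "c * x + d = 0")
    case True
    have "c \<noteq> 0" using True assms by auto
    moreover have "d = - c * x" using True by simp
    ultimately show ?thesis using Fin by (simp add: mobius_inv_def)
  next
    case False
    have 1: "- c * ((a * x + b) / (c * x + d)) + a = (a * d - b * c) / (c * x + d)"
      using False by (simp add: field_simps)
    have 2: "d * ((a * x + b) / (c * x + d)) + - b = x * (a * d - b * c) / (c * x + d)"
      using False by (simp add: field_simps)
    have "mobius d (- b) (- c) a (Fin ((a * x + b) / (c * x + d))) = Fin x"
      unfolding mobius.simps 1 2 using False assms by simp
    then show ?thesis using Fin False by (simp add: mobius_inv_def)
  qed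
next
  case Infty
  then show ?thesis using assms by (auto simp: mobius_inv_def)
qed

text \<open>Expressions at the point at infinity are limits for \<open>x \<rightarrow> \<plusminus>\<infinity>\<close>; on the reals
  \<open>at_infinity\<close> is the supremum of \<open>at_top\<close> and \<open>at_bot\<close>.\<close>

fun value_at :: "(real \<Rightarrow> 'a::t2_space) \<Rightarrow> rproj \<Rightarrow> 'a" where
  "value_at F (Fin x) = F x"
| "value_at F Infty = Lim at_infinity F"

definition fP :: "real \<Rightarrow> real^3" where
  "fP x = vector [1, x, x\<^sup>2]"

definition gP :: "real \<Rightarrow> real^3" where
  "gP x = vector_derivative fP (at x)"

definition sigmaP2 :: "real \<Rightarrow> real \<Rightarrow> real \<Rightarrow> real \<Rightarrow> real \<Rightarrow> real" where
  "sigmaP2 a b c d x = ((b\<^sup>2 + d\<^sup>2) + 2 * (a * b + c * d) * x + (a\<^sup>2 + c\<^sup>2) * x\<^sup>2)\<^sup>2"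

text \<open>A design is encoded by its weight function: \<open>w y\<close> is the weight of the point \<open>y\<close>, and
  \<open>w y = 0\<close> if \<open>y\<close> is not a point of the design.\<close>

type_synonym weights = "rproj \<Rightarrow> real"

definition supp :: "weights \<Rightarrow> rproj set" where
  "supp w = {y. w y \<noteq> 0}"

definition design :: "weights \<Rightarrow> bool" where
  "design w \<longleftrightarrow> finite (supp w) \<and> (\<forall>y\<in>supp w. w y > 0) \<and> (\<Sum>y\<in>supp w. w y) = 1"

definition three_point :: "weights \<Rightarrow> bool" where
  "three_point w \<longleftrightarrow> card (supp w) = 3"

text \<open>The weight function with weight \<open>p i\<close> at \<open>x i\<close> for \<open>i = 1, 2, 3\<close>.\<close>

definition weights_of :: "(nat \<Rightarrow> rproj) \<Rightarrow> (nat \<Rightarrow> real) \<Rightarrow> weights" where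
  "weights_of x p y = (\<Sum>i\<in>{i\<in>{1..3}. x i = y}. p i)"

definition info_matrix :: "(real \<Rightarrow> real) \<Rightarrow> weights \<Rightarrow> real^3^3" where
  "info_matrix \<sigma>2 w =
     (\<Sum>y\<in>supp w. w y *\<^sub>R value_at (\<lambda>x. \<chi> i j. fP x $ i * fP x $ j / \<sigma>2 x) y)"

definition Vol1 :: "real^3^3 \<Rightarrow> real" where
  "Vol1 \<Sigma> = 2 * (LBINT x. sqrt ((fP x \<bullet> (\<Sigma> *v fP x)) * (gP x \<bullet> (\<Sigma> *v gP x))
                                - (fP x \<bullet> (\<Sigma> *v gP x))\<^sup>2) / (fP x \<bullet> (\<Sigma> *v fP x)))"

definition tube_volume_optimal :: "(real \<Rightarrow> real) \<Rightarrow> weights \<Rightarrow> bool" where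
  "tube_volume_optimal \<sigma>2 w \<longleftrightarrow> design w \<and> invertible (info_matrix \<sigma>2 w) \<and>
     (\<forall>v. design v \<and> invertible (info_matrix \<sigma>2 v) \<longrightarrow>
        Vol1 (matrix_inv (info_matrix \<sigma>2 w)) \<le> Vol1 (matrix_inv (info_matrix \<sigma>2 v)))"

definition D_optimal :: "(real \<Rightarrow> real) \<Rightarrow> weights \<Rightarrow> bool" where
  "D_optimal \<sigma>2 w \<longleftrightarrow> design w \<and>
     (\<forall>v. design v \<longrightarrow> det (info_matrix \<sigma>2 v) \<le> det (info_matrix \<sigma>2 w))"

text \<open>The values \<open>-1/3, 0, 1/3\<close> for \<open>i = 1, 2, 3\<close>.\<close>

definition t0 :: "nat \<Rightarrow> real" where
  "t0 i = (real i - 2) / 3"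

definition opt_point :: "real \<Rightarrow> real \<Rightarrow> real \<Rightarrow> real \<Rightarrow> nat \<Rightarrow> rproj" where
  "opt_point a b c d i = mobius_inv a b c d (Fin (tan (pi * t0 i)))"

definition var_ratio ::
  "real \<Rightarrow> real \<Rightarrow> real \<Rightarrow> real \<Rightarrow> real \<Rightarrow> real \<Rightarrow> real \<Rightarrow> real \<Rightarrow> rproj \<Rightarrow> real" where
  "var_ratio a0 b0 c0 d0 a b c d = value_at (\<lambda>x. sigmaP2 a0 b0 c0 d0 x / sigmaP2 a b c d x)"

text \<open>\<open>opt_design a0 b0 c0 d0 a b c d w\<close>: the design \<open>w\<close> has the points \<open>x i\<close> and weights \<open>p i\<close>
  obtained from the parameters \<open>a, b, c, d\<close>, with \<open>k\<close> the normalising constant.\<close>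

definition opt_design ::
  "real \<Rightarrow> real \<Rightarrow> real \<Rightarrow> real \<Rightarrow> real \<Rightarrow> real \<Rightarrow> real \<Rightarrow> real \<Rightarrow> weights \<Rightarrow> bool" where
  "opt_design a0 b0 c0 d0 a b c d w \<longleftrightarrow> (\<exists>k x p. k > 0 \<and> (\<Sum>i=1..3. p i) = 1 \<and>
     (\<forall>i\<in>{1..3}. x i = opt_point a b c d i \<and> p i = k * var_ratio a0 b0 c0 d0 a b c d (x i)) \<and>
     w = weights_of x p)"

end

theory Submission
  imports Defs "HOL-Real_Asymp.Real_Asymp" "HOL-Computational_Algebra.Fundamental_Theorem_Algebra"
begin

text \<open>A linear map of the homogeneous coordinates of the points acts on \<open>fP\<close> through its symmetric
  square, up to a scalar factor, so the length is invariant under congruence of the information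
  matrix \<open>M\<close> by symmetric squares. A Hankel matrix \<open>M\<close> is encoded by the binary quartic
  \<open>\<Sum>\<^sub>i \<tau>\<^sub>i (x y\<^sub>i - z x\<^sub>i)\<^sup>4\<close>, which is positive if \<open>M\<close> is positive definite. It is then a product of two
  definite quadratic forms, and diagonalising these simultaneously brings it to a multiple of
  \<open>x\<^sup>4 + 6 m x\<^sup>2 z\<^sup>2 + z\<^sup>4\<close> with \<open>0 < m \<le> 1/3\<close>. The length of this normal form is bounded below by
  an elementary integral, with equality only for \<open>m = 1/3\<close>, that is, when the quartic is the square of
  a definite quadratic form \<open>(a x + b z)\<^sup>2 + (c x + d z)\<^sup>2\<close>. If such a square is a positive
  combination of three fourth powers of linear forms, then rescaling these forms to have sum zero
  makes the three weights equal, which yields the stated family. D-optimality means that the quadratic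
  form is proportional to the one in the given variance function.\<close>

section \<open>Integrals over the real line\<close>

text \<open>For \<open>m < 1/3\<close> the length of the normal form is an elliptic integral, so it
  is never evaluated: it is only compared strictly with the case \<open>m = 1/3\<close>, where the
  square root disappears. The quartic is normalised because the length sees it directly: the Gram
  determinant under the root is, up to a constant factor, the quartic at \<open>(x, 1)\<close>. The
  two bounds on \<open>m\<close> have different origins. Positivity of the quartic alone gives
  \<open>m > -1/3\<close>; \<open>m > 0\<close> comes from positive definiteness of the matrix,
  while \<open>m \<le> 1/3\<close> is a choice between two palindromic forms of one quartic,
  exchanged by a rotation by 45 degrees. The bound holds for all designs with nonsingular
  information matrix; the number of points matters only in passing from the squared quadratic form
  to points and weights. A Moebius map determines its quadratic form up to a factor, but the form
  forgets the orientation. Composing with a rotation preserves the sign of the determinant, so the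
  D-optimal case needs parameters with a prescribed sign.\<close>

lemma has_bochner_integral_FTC_UNIV:
  fixes f F :: "real \<Rightarrow> real"
  assumes "\<And>x. (F has_real_derivative f x) (at x)" "\<And>x. isCont f x" "\<And>x. 0 \<le> f x"
    and "(F \<longlongrightarrow> A) at_bot" "(F \<longlongrightarrow> B) at_top"
  shows "has_bochner_integral lborel f (B - A)"
proof -
  have A: "((F \<circ> real_of_ereal) \<longlongrightarrow> A) (at_right (-\<infinity>))"
    using assms(4) by (simp add: ereal_tendsto_simps)
  have B: "((F \<circ> real_of_ereal) \<longlongrightarrow> B) (at_left \<infinity>)"
    using assms(5) by (simp add: ereal_tendsto_simps)
  have "set_integrable lborel (einterval (-\<infinity>) \<infinity>) f" "(LBINT x=-\<infinity>..\<infinity>. f x) = B - A"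
    using interval_integral_FTC_nonneg[OF _ assms(1) assms(2) _ A B] assms(3) by auto
  then show ?thesis
    by (simp add: has_bochner_integral_iff set_integrable_def interval_lebesgue_integral_def
        set_lebesgue_integral_def)
qed

lemma has_integral_inverse_one_plus_square:
  "has_bochner_integral lborel (\<lambda>x::real. 1 / (1 + x\<^sup>2)) pi"
proof -
  have "has_bochner_integral lborel (\<lambda>x::real. 1 / (1 + x\<^sup>2)) (pi/2 - (-(pi/2)))"
  proof (rule has_bochner_integral_FTC_UNIV)
    show "(arctan has_real_derivative 1 / (1 + x\<^sup>2)) (at x)" for x
      by (rule derivative_eq_intros refl | simp add: field_simps)+
    show "isCont (\<lambda>x::real. 1 / (1 + x\<^sup>2)) x" for x
      by (intro continuous_intros) (smt (verit) zero_le_power2)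
  qed (auto intro: tendsto_arctan_at_bot tendsto_arctan_at_top)
  then show ?thesis by simp
qed

text \<open>This is the part of \<open>q / s^3\<close> in \<open>canon_integral_gt\<close> that is
  not a multiple of \<open>1 / s\<close>.\<close>

lemma has_integral_square_over_cube:
  "has_bochner_integral lborel (\<lambda>x::real. x\<^sup>2 / (1 + x\<^sup>2)^3) (pi/8)"
proof -
  let ?F = "\<lambda>x::real. arctan x / 8 + (x^3 - x) / (8 * (1 + x\<^sup>2)\<^sup>2)"
  have pos: "1 + x\<^sup>2 > 0" for x :: real by (smt (verit) zero_le_power2)
  have "has_bochner_integral lborel (\<lambda>x::real. x\<^sup>2 / (1 + x\<^sup>2)^3) (pi/16 - (-(pi/16)))"
  proof (rule has_bochner_integral_FTC_UNIV)
    show "(?F has_real_derivative x\<^sup>2 / (1 + x\<^sup>2)^3) (at x)" for x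
    proof -
      have *: "inverse (1 + x\<^sup>2) / 8 + ((3 * x\<^sup>2 - 1) * (8 * (1 + x\<^sup>2)\<^sup>2) - (x^3 - x) * (32 * (1+x\<^sup>2) * x)) / (8 * (1 + x\<^sup>2)\<^sup>2)\<^sup>2
        = x\<^sup>2 / (1 + x\<^sup>2)^3"
        using pos[of x] by (simp add: divide_simps) algebra
      show ?thesis
      proof (rule DERIV_cong[OF _ *])
        have n: "8 * (1 + x\<^sup>2)\<^sup>2 \<noteq> 0" using pos[of x] by simp
        have 1: "((\<lambda>x. arctan x / 8) has_real_derivative inverse (1 + x\<^sup>2) / 8) (at x)"
          by (intro DERIV_cdivide DERIV_arctan)
        have 2: "((\<lambda>x. x^3 - x) has_real_derivative 3 * x\<^sup>2 - 1) (at x)"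
          by (auto intro!: derivative_eq_intros)
        have 3: "((\<lambda>x. 8 * (1 + x\<^sup>2)\<^sup>2) has_real_derivative 32 * (1+x\<^sup>2) * x) (at x)"
          by (auto intro!: derivative_eq_intros)
        show "(?F has_real_derivative inverse (1 + x\<^sup>2) / 8 + ((3 * x\<^sup>2 - 1) * (8 * (1 + x\<^sup>2)\<^sup>2) - (x^3 - x) * (32 * (1+x\<^sup>2) * x)) / (8 * (1 + x\<^sup>2)\<^sup>2)\<^sup>2) (at x)"
          using DERIV_add[OF 1 DERIV_divide[OF 2 3 n]] by (simp add: power2_eq_square)
      qed
    qed
    show "isCont (\<lambda>x::real. x\<^sup>2 / (1 + x\<^sup>2)^3) x" for x
      using pos[of x] by (intro continuous_intros) auto
    show "0 \<le> x\<^sup>2 / (1 + x\<^sup>2)^3" for x :: real using pos[of x] by simp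
    have 1: "((\<lambda>x::real. (x^3 - x) / (8 * (1 + x\<^sup>2)\<^sup>2)) \<longlongrightarrow> 0) at_top" by real_asymp
    have 2: "((\<lambda>x::real. (x^3 - x) / (8 * (1 + x\<^sup>2)\<^sup>2)) \<longlongrightarrow> 0) at_bot" by real_asymp
    show "(?F \<longlongrightarrow> -(pi/16)) at_bot"
      using tendsto_add[OF tendsto_divide[OF tendsto_arctan_at_bot tendsto_const[of 8]] 2] by simp
    show "(?F \<longlongrightarrow> pi/16) at_top"
      using tendsto_add[OF tendsto_divide[OF tendsto_arctan_at_top tendsto_const[of 8]] 1] by simp
  qed
  then show ?thesis by simp
qed

text \<open>Partial fractions: the integrand is
  \<open>(1 / (x^2 + k^2) + 1 / (k^2 * x^2 + 1)) / (1 + k^2)\<close>.\<close>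

lemma has_integral_poisson_type:
  fixes k :: real assumes "k > 0"
  shows "has_bochner_integral lborel (\<lambda>x. (1 + x\<^sup>2) / ((x\<^sup>2 + k\<^sup>2) * (k\<^sup>2 * x\<^sup>2 + 1))) (2 * pi / (k * (1 + k\<^sup>2)))"
proof -
  let ?F = "\<lambda>x::real. (arctan (x / k) + arctan (k * x)) / (k * (1 + k\<^sup>2))"
  have pos: "x\<^sup>2 + k\<^sup>2 > 0" "k\<^sup>2 * x\<^sup>2 + 1 > 0" for x :: real
    using assms by (simp_all add: add_nonneg_pos)
  have k1: "1 + k\<^sup>2 > 0" by (smt (verit) zero_le_power2)
  have "has_bochner_integral lborel (\<lambda>x. (1 + x\<^sup>2) / ((x\<^sup>2 + k\<^sup>2) * (k\<^sup>2 * x\<^sup>2 + 1)))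
     ((pi/2 + pi/2) / (k * (1 + k\<^sup>2)) - ((-(pi/2)) + (-(pi/2))) / (k * (1 + k\<^sup>2)))"
  proof (rule has_bochner_integral_FTC_UNIV)
    show "(?F has_real_derivative (1 + x\<^sup>2) / ((x\<^sup>2 + k\<^sup>2) * (k\<^sup>2 * x\<^sup>2 + 1))) (at x)" for x
    proof -
      have a: "1 + (x/k)\<^sup>2 = (x\<^sup>2 + k\<^sup>2) / k\<^sup>2" using assms by (simp add: field_simps)
      have D: "(inverse (1 + (x/k)\<^sup>2) * (1 / k) + inverse (1 + (k * x)\<^sup>2) * k) / (k * (1 + k\<^sup>2))
         = (1 + x\<^sup>2) / ((x\<^sup>2 + k\<^sup>2) * (k\<^sup>2 * x\<^sup>2 + 1))"
        unfolding a using pos[of x] k1 assms by (simp add: divide_simps power_mult_distrib) algebra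
      have "((\<lambda>x. arctan (x / k)) has_real_derivative inverse (1 + (x/k)\<^sup>2) * (1 / k)) (at x)"
        "((\<lambda>x. arctan (k * x)) has_real_derivative inverse (1 + (k * x)\<^sup>2) * k) (at x)"
        using assms by (auto intro!: derivative_eq_intros)
      then show ?thesis
        unfolding D[symmetric] by (intro DERIV_cdivide DERIV_add)
    qed
    show "isCont (\<lambda>x. (1 + x\<^sup>2) / ((x\<^sup>2 + k\<^sup>2) * (k\<^sup>2 * x\<^sup>2 + 1))) x" for x
      using pos[of x] by (intro continuous_intros) auto
    show "0 \<le> (1 + x\<^sup>2) / ((x\<^sup>2 + k\<^sup>2) * (k\<^sup>2 * x\<^sup>2 + 1))" for x
      using pos[of x] by (intro divide_nonneg_pos mult_pos_pos) auto
    have t: "filterlim (\<lambda>x. x / k) at_top at_top" "filterlim (\<lambda>x. x / k) at_bot at_bot"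
       "filterlim (\<lambda>x. k * x) at_top at_top" "filterlim (\<lambda>x. k * x) at_bot at_bot"
      using assms by real_asymp+
    show "(?F \<longlongrightarrow> ((-(pi/2)) + (-(pi/2))) / (k * (1 + k\<^sup>2))) at_bot"
      using assms k1
      by (intro tendsto_divide tendsto_add tendsto_const filterlim_compose[OF tendsto_arctan_at_bot] t) auto
    show "(?F \<longlongrightarrow> (pi/2 + pi/2) / (k * (1 + k\<^sup>2))) at_top"
      using assms k1
      by (intro tendsto_divide tendsto_add tendsto_const filterlim_compose[OF tendsto_arctan_at_top] t) auto
  qed
  then show ?thesis by (simp add: field_simps)
qed

text \<open>The denominator is palindromic in \<open>x^2\<close>, hence a multiple of
  \<open>(x^2 + k^2) * (k^2 * x^2 + 1)\<close> where \<open>k + 1/k = r\<close>. A real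
  \<open>k\<close> exists if \<open>r \<ge> 2\<close>, which amounts to
  \<open>(1 - 3 * m) * (1 + m) \<ge> 0\<close>; here \<open>m \<le> 1/3\<close> enters.\<close>

lemma has_integral_palindromic:
  fixes m :: real assumes "0 < m" "m \<le> 1/3"
  shows "has_bochner_integral lborel (\<lambda>x. (1 + x\<^sup>2) / (m * x^4 + (1 - 3 * m\<^sup>2) * x\<^sup>2 + m))
           (2 * pi / sqrt (m * (1 - m) * (1 + 3 * m)))"
proof -
  define r where "r = sqrt ((1 - m) * (1 + 3 * m) / m)"
  have r2: "r\<^sup>2 = (1 - m) * (1 + 3 * m) / m" using assms by (simp add: r_def)
  have "(1 - 3 * m) * (1 + m) \<ge> 0" using assms by (intro mult_nonneg_nonneg) auto
  then have r4: "r\<^sup>2 \<ge> 4" unfolding r2 using assms by (simp add: field_simps power2_eq_square)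
  have r0: "r > 0" using assms by (simp add: r_def)
  define k where "k = (r + sqrt (r\<^sup>2 - 4)) / 2"
  have k0: "k > 0" using r0 r4 by (simp add: k_def add_pos_nonneg)
  have "(2 * k - r)\<^sup>2 = r\<^sup>2 - 4" using r4 unfolding k_def by (simp add: add_divide_distrib)
  then have kr: "k\<^sup>2 + 1 = r * k" by (simp add: power2_eq_square algebra_simps)
  have mr: "m * r\<^sup>2 = (1 - m) * (1 + 3 * m)" using assms r2 by simp
  have k4: "m * (k^4 + 1) = (1 - 3 * m\<^sup>2) * k\<^sup>2"
  proof -
    have "(k\<^sup>2 + 1)\<^sup>2 = r\<^sup>2 * k\<^sup>2" by (simp add: kr power_mult_distrib)
    then have "m * (k\<^sup>2 + 1)\<^sup>2 = (1 - m) * (1 + 3 * m) * k\<^sup>2" using mr by (metis mult.assoc)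
    then show ?thesis by (simp add: power2_eq_square power4_eq_xxxx algebra_simps)
  qed
  have q: "k\<^sup>2 / m * (m * x^4 + (1 - 3 * m\<^sup>2) * x\<^sup>2 + m) = (x\<^sup>2 + k\<^sup>2) * (k\<^sup>2 * x\<^sup>2 + 1)" for x
  proof -
    have "k\<^sup>2 * (m * x^4 + (1 - 3 * m\<^sup>2) * x\<^sup>2 + m) = k\<^sup>2 * m * x^4 + m * (k^4+1) * x\<^sup>2 + m * k\<^sup>2"
      unfolding k4 by (simp add: algebra_simps)
    also have "\<dots> = m * ((x\<^sup>2 + k\<^sup>2) * (k\<^sup>2 * x\<^sup>2 + 1))" by algebra
    finally have "k\<^sup>2 * (m * x^4 + (1 - 3 * m\<^sup>2) * x\<^sup>2 + m) / m = (x\<^sup>2 + k\<^sup>2) * (k\<^sup>2 * x\<^sup>2 + 1)"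
      using assms(1) by (metis less_irrefl nonzero_mult_div_cancel_left)
    then show ?thesis by (simp only: times_divide_eq_left)
  qed
  have "(1 + x\<^sup>2) / (m * x^4 + (1 - 3 * m\<^sup>2) * x\<^sup>2 + m) = k\<^sup>2 / m * ((1 + x\<^sup>2) / ((x\<^sup>2 + k\<^sup>2) * (k\<^sup>2 * x\<^sup>2 + 1)))" for x
    unfolding q[symmetric] using assms(1) k0 by (simp only: mult_divide_mult_cancel_left times_divide_eq_right divide_eq_0_iff) simp
  moreover have "k\<^sup>2 / m * (2 * pi / (k * (1 + k\<^sup>2))) = 2 * pi / sqrt (m * (1 - m) * (1 + 3 * m))"
  proof -
    have "sqrt (m * (1 - m) * (1 + 3 * m)) = sqrt (m\<^sup>2 * r\<^sup>2)"
      by (simp add: mult.assoc mr[symmetric] power2_eq_square)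
    also have "\<dots> = m * r" using assms r0 by (simp add: real_sqrt_mult)
    finally show ?thesis using kr k0 r0 assms by (simp add: add.commute field_simps power2_eq_square)
  qed
  ultimately show ?thesis
    using has_bochner_integral_mult_right[OF has_integral_poisson_type[OF k0], of "k\<^sup>2/m"] by simp
qed

section \<open>The one-parameter family of lengths\<close>

text \<open>The left side is the tangent line of the convex function \<open>1 / sqrt y\<close> at
  \<open>y = 1 / e^2\<close>. In terms of \<open>r = e * sqrt y\<close> the gap is a positive
  multiple of \<open>(r - 1)^2 * (r + 2)\<close>.\<close>

lemma inverse_sqrt_ge_tangent:
  fixes y e :: real assumes "y > 0" "e > 0"
  shows "e * (3/2 - e\<^sup>2 * y / 2) \<le> 1 / sqrt y"
proof -
  define r where "r = e * sqrt y"
  have r: "r > 0" "r\<^sup>2 = e\<^sup>2 * y" using assms by (auto simp: r_def power_mult_distrib)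
  have "(r - 1)\<^sup>2 * (r + 2) \<ge> 0" using r by simp
  then have "r * (3/2 - r\<^sup>2 / 2) \<le> 1" by (simp add: power2_eq_square algebra_simps)
  then have "sqrt y * (e * (3/2 - e\<^sup>2 * y / 2)) \<le> 1" unfolding r(2)[symmetric] by (simp add: r_def mult_ac)
  then show ?thesis using assms by (simp add: field_simps)
qed

text \<open>For \<open>0 < m < 1\<close> this is the function \<open>speed\<close> of the inverse of
  \<open>canon_mat k m\<close>, in which the positive factor \<open>k\<close> cancels.\<close>

definition canon_integrand :: "real \<Rightarrow> real \<Rightarrow> real" where
  "canon_integrand m x = sqrt (m * (1 - m\<^sup>2)) * sqrt (x^4 + 6 * m * x\<^sup>2 + 1)
     / (m * x^4 + (1 - 3 * m\<^sup>2) * x\<^sup>2 + m)"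

text \<open>Both quartics degenerate to multiples of \<open>(1 + x^2)^2\<close>. The value is half
  of the minimal \<open>Vol1\<close>.\<close>

lemma canon_integrand_third:
  "has_bochner_integral lborel (canon_integrand (1/3)) (pi * sqrt (8/3))"
proof -
  have "canon_integrand (1/3) x = sqrt (8/3) * (1 / (1 + x\<^sup>2))" for x
  proof -
    have s: "1 + x\<^sup>2 > 0" by (smt (verit) zero_le_power2)
    have 1: "x^4 + 6 * (1/3) * x\<^sup>2 + 1 = (1 + x\<^sup>2)\<^sup>2" by (simp add: power2_eq_square power4_eq_xxxx algebra_simps)
    have 2: "(1/3) * x^4 + (1 - 3 * (1/3)\<^sup>2) * x\<^sup>2 + 1/3 = (1 + x\<^sup>2)\<^sup>2 / 3"
      by (simp add: power2_eq_square power4_eq_xxxx algebra_simps)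
    have 3: "sqrt (1/3 * (1 - (1/3)\<^sup>2)) = sqrt (8/3) / 3"
    proof -
      have "1/3 * (1 - (1/3)\<^sup>2) = (8/3::real) / 3\<^sup>2" by (simp add: power2_eq_square)
      then show ?thesis by (simp only: real_sqrt_divide) simp
    qed
    show ?thesis unfolding canon_integrand_def 1 2 3 using s by (simp add: power2_eq_square)
  qed
  then have "canon_integrand (1/3) = (\<lambda>x. sqrt (8/3) * (1 / (1 + x\<^sup>2)))" by blast
  then show ?thesis
    using has_bochner_integral_mult_right[OF has_integral_inverse_one_plus_square, of "sqrt (8/3)"]
    by (simp add: mult.commute)
qed

text \<open>With \<open>s = 1 + x\<^sup>2\<close> the numerator \<open>p\<close> under the root satisfies \<open>p = a s\<^sup>2 - b q\<close>, where \<open>q\<close> is the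
  denominator. Writing \<open>\<surd>p = p / \<surd>p\<close> and replacing the last factor by a tangent line makes the
  integrand rational; \<open>e\<close> is the slope parameter giving the best bound. In terms of \<open>v\<close> the result
  reduces to \<open>(v - 1) (2 v - 3) (v - 3) > 0\<close>.\<close>

lemma canon_integral_gt:
  fixes m :: real assumes m: "0 < m" "m < 1/3"
  shows "integral\<^sup>L lborel (canon_integrand m) > pi * sqrt (8/3)"
proof -
  define D where "D = m * (1 - m\<^sup>2)"
  define a where "a = (1 + 3 * m) / (1 + m)"
  define b where "b = 2 / (1 + m)"
  \<comment> \<open>\<open>v\<close> is the ratio of \<open>a * I\<close> to \<open>b * pi\<close>,
    the integrals of the two terms of \<open>p / (s * q) = a * s / q - b / s\<close>. It exceeds 3
    because \<open>(1 - 3 * m)^2 > 0\<close>.\<close>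
  define v where "v = sqrt ((1 + 3 * m) / (m * (1 - m)))"
  define I where "I = 2 * pi / sqrt (m * (1 - m) * (1 + 3 * m))"
  \<comment> \<open>\<open>pi * n\<close>, \<open>P\<close> and \<open>Q\<close> are the integrals
    of \<open>q / s^3\<close>, \<open>p / (s * q)\<close> and \<open>p^2 / (s^3 * q)\<close>. The
    choice \<open>e^2 = P / Q\<close> maximises \<open>e * (3/2 * P - e^2 / 2 * Q)\<close>, the
    integral of the tangent bound up to the factor \<open>sqrt D\<close>.\<close>
  define n where "n = (1 + 6 * m - 3 * m\<^sup>2) / 8"
  define P where "P = a * I - b * pi"
  define Q where "Q = a\<^sup>2 * I - 2 * a * b * pi + b\<^sup>2 * (pi * n)"
  define e where "e = sqrt (P / Q)"
  have m1: "m * m < 1 * 1" by (rule mult_strict_mono) (use m in auto)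
  have D0: "D > 0" using m m1 by (simp add: D_def power2_eq_square)
  have a0: "a > 0" and b0: "b > 0" using m by (simp_all add: a_def b_def)
  have ab: "a = b * (1 + 3 * m) / 2" unfolding a_def b_def using m by (simp add: divide_simps) (simp add: algebra_simps)
  have mm: "m * (1 - m) > 0" using m by simp
  have v2: "v\<^sup>2 = (1 + 3 * m) / (m * (1 - m))" using m by (simp add: v_def)
  have vm: "m * (1 - m) * v\<^sup>2 = 1 + 3 * m" unfolding v2 using mm by auto
  have "(1 - 3 * m)\<^sup>2 > 0" using m by simp
  then have "9 * (m * (1 - m)) < 1 + 3 * m" by (simp add: power2_eq_square algebra_simps)
  then have "3\<^sup>2 < v\<^sup>2" unfolding v2 using mm by (simp add: pos_less_divide_eq)
  then have v3: "v > 3" by (rule power_less_imp_less_base) (unfold v_def, intro real_sqrt_ge_zero divide_nonneg_pos mm, use m in simp)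
  have aI: "a * I = b * pi * v"
  proof -
    define A B where "A = sqrt (m * (1 - m))" and "B = sqrt (1 + 3 * m)"
    have AB: "A > 0" "B > 0" "1 + 3 * m = B * B" "v = B / A" "sqrt (m * (1 - m) * (1 + 3 * m)) = A * B"
      using m mm by (simp_all only: A_def B_def v_def real_sqrt_mult real_sqrt_divide) auto
    show ?thesis unfolding ab I_def unfolding AB(5) unfolding AB(3,4) using AB(1,2) by simp
  qed
  have P: "P = b * pi * (v - 1)" unfolding P_def aI by (simp add: algebra_simps)
  have n: "n = (1 + 3 * m) * (1 + 3 / v\<^sup>2) / 8"
  proof -
    have "(1 + 3 * m) / v\<^sup>2 = m * (1 - m)" using vm v3 by (simp add: field_simps)
    moreover have "(1 + 3 * m) * (1 + 3 / v\<^sup>2) = 1 + 3 * m + 3 * ((1 + 3 * m) / v\<^sup>2)"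
      by (simp add: algebra_simps add_divide_distrib)
    ultimately have "(1 + 3 * m) * (1 + 3 / v\<^sup>2) = 1 + 3 * m + 3 * (m * (1 - m))" by simp
    then show ?thesis unfolding n_def by (simp add: power2_eq_square right_diff_distrib)
  qed
  have Q: "Q = b\<^sup>2 * pi * ((1 + 3 * m) * ((v - 2) / 2 + (1 + 3 / v\<^sup>2) / 8))"
  proof -
    have "Q = a * (a * I) - 2 * a * b * pi + b\<^sup>2 * (pi * n)" by (simp add: Q_def power2_eq_square)
    also have "\<dots> = a * b * pi * (v - 2) + b\<^sup>2 * (pi * n)" unfolding aI by (simp add: algebra_simps)
    also have "\<dots> = b\<^sup>2 * pi * ((1 + 3 * m) / 2 * (v - 2) + n)" unfolding ab
      by (simp add: power2_eq_square algebra_simps)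
    also have "(1 + 3 * m) / 2 * (v - 2) + n = (1 + 3 * m) * ((v - 2) / 2 + (1 + 3 / v\<^sup>2) / 8)"
      unfolding n by (simp add: field_simps)
    finally show ?thesis .
  qed
  have P0: "P > 0" unfolding P using b0 v3 by simp
  have "1 + 3 / v\<^sup>2 > 0" by (rule add_pos_nonneg) auto
  then have "(v - 2) / 2 + (1 + 3 / v\<^sup>2) / 8 > 0" using v3 by (intro add_pos_pos divide_pos_pos) auto
  then have Q0: "Q > 0" unfolding Q using b0 m by simp
  have e0: "e > 0" and e2: "e\<^sup>2 = P / Q" using P0 Q0 by (simp_all add: e_def)
  let ?s = "\<lambda>x::real. 1 + x\<^sup>2"
  let ?q = "\<lambda>x::real. m * x^4 + (1 - 3 * m\<^sup>2) * x\<^sup>2 + m"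
  let ?p = "\<lambda>x::real. x^4 + 6 * m * x\<^sup>2 + 1"
  have s0: "?s x > 0" for x :: real by (smt (verit) zero_le_power2)
  have q_alt: "?q x = m * (?s x)\<^sup>2 + (1 - 3 * m) * (1 + m) * x\<^sup>2" for x
    by (simp add: power2_eq_square power4_eq_xxxx algebra_simps)
  have q0: "?q x > 0" for x unfolding q_alt using m s0[of x] by (intro add_pos_nonneg mult_nonneg_nonneg) auto
  have p0: "?p x > 0" for x using m by (intro add_nonneg_pos add_nonneg_nonneg) auto
  have pq: "?p x = a * (?s x)\<^sup>2 - b * ?q x" for x
  proof -
    have "(1 + m) * ?p x = (1 + 3 * m) * (?s x)\<^sup>2 - 2 * ?q x"
      by (simp add: power2_eq_square power4_eq_xxxx algebra_simps)
    moreover have "p = (A * S - 2 * q) / (1 + m) \<longleftrightarrow> p = A / (1 + m) * S - 2 / (1 + m) * q" for p A S q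
      by (simp add: diff_divide_distrib)
    ultimately show ?thesis unfolding a_def b_def using m
      by (metis add_pos_pos less_irrefl nonzero_mult_div_cancel_left zero_less_one)
  qed
  \<comment> \<open>The tangent bound is applied at \<open>p / s^2\<close>; eliminating
    \<open>p\<close> leaves only functions integrated before.\<close>
  define L where "L x = sqrt D * (e * ((3/2) * (a * (?s x / ?q x) - b * (1 / ?s x))
      - e\<^sup>2 / 2 * (a\<^sup>2 * (?s x / ?q x) - 2 * a * b * (1 / ?s x)
          + b\<^sup>2 * (m * (1 / ?s x) + (1 - 3 * m) * (1 + m) * (x\<^sup>2 / (?s x)^3)))))" for x
  have i1: "has_bochner_integral lborel (\<lambda>x. ?s x / ?q x) I"
    unfolding I_def by (rule has_integral_palindromic) (use m in auto)
  have i3: "has_bochner_integral lborel (\<lambda>x. m * (1 / ?s x) + (1 - 3 * m) * (1 + m) * (x\<^sup>2 / (?s x)^3))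
      (m * pi + (1 - 3 * m) * (1 + m) * (pi/8))"
    by (intro has_bochner_integral_add has_bochner_integral_mult_right
        has_integral_inverse_one_plus_square has_integral_square_over_cube)
  have i3v: "m * pi + (1 - 3 * m) * (1 + m) * (pi/8) = pi * n"
    unfolding n_def by (simp add: power2_eq_square algebra_simps add_divide_distrib diff_divide_distrib)
  have iL: "has_bochner_integral lborel L (sqrt D * (e * ((3/2) * (a * I - b * pi)
      - e\<^sup>2 / 2 * (a\<^sup>2 * I - 2 * a * b * pi + b\<^sup>2 * (pi * n)))))"
    unfolding L_def
    by (intro has_bochner_integral_add has_bochner_integral_diff has_bochner_integral_mult_right
        i1 i3[unfolded i3v] has_integral_inverse_one_plus_square)
  have iL': "has_bochner_integral lborel L (sqrt D * (e * P))"
  proof -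
    have "e\<^sup>2 / 2 * Q = P / 2" using Q0 by (simp add: e2)
    then have "(3/2) * P - e\<^sup>2 / 2 * Q = P" by simp
    then show ?thesis using iL unfolding P_def[symmetric] Q_def[symmetric] by simp
  qed
  have LG: "L x \<le> canon_integrand m x" for x
  proof -
    define s q p where "s = ?s x" and "q = ?q x" and "p = ?p x"
    have pos: "s > 0" "q > 0" "p > 0" using s0 q0 p0 by (simp_all add: s_def q_def p_def)
    have pq': "p = a * s\<^sup>2 - b * q" using pq by (simp add: s_def q_def p_def)
    have q_alt': "m * (1 / s) + (1 - 3 * m) * (1 + m) * (x\<^sup>2 / s^3) = q / s^3"
    proof -
      have "q = m * s\<^sup>2 + (1 - 3 * m) * (1 + m) * x\<^sup>2" using q_alt by (simp add: s_def q_def)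
      then show ?thesis using pos by (simp add: add_divide_distrib power2_eq_square power3_eq_cube)
    qed
    have 1: "a * (s / q) - b * (1 / s) = p / (s * q)" using pos unfolding pq'
      by (simp add: field_simps power2_eq_square)
    have 2: "a\<^sup>2 * (s / q) - 2 * a * b * (1 / s) + b\<^sup>2 * (q / s^3) = p\<^sup>2 / (s^3 * q)" using pos unfolding pq'
      by (simp add: divide_simps) algebra
    have L: "L x = sqrt D * (p / (s * q) * (e * (3/2 - e\<^sup>2 * (p / s\<^sup>2) / 2)))"
    proof -
      have "L x = sqrt D * (e * ((3/2) * (p / (s * q)) - e\<^sup>2 / 2 * (p\<^sup>2 / (s^3 * q))))"
        unfolding L_def using q_alt' 1 2 by (simp add: s_def q_def)
      also have "(3/2) * (p / (s * q)) - e\<^sup>2 / 2 * (p\<^sup>2 / (s^3 * q)) = p / (s * q) * (3/2 - e\<^sup>2 * (p / s\<^sup>2) / 2)"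
        using pos by (simp add: divide_simps) algebra
      finally show ?thesis by simp
    qed
    have "e * (3/2 - e\<^sup>2 * (p / s\<^sup>2) / 2) \<le> 1 / sqrt (p / s\<^sup>2)"
      by (rule inverse_sqrt_ge_tangent) (use pos e0 in auto)
    also have "1 / sqrt (p / s\<^sup>2) = s / sqrt p" using pos by (simp add: real_sqrt_divide)
    finally have "p / (s * q) * (e * (3/2 - e\<^sup>2 * (p / s\<^sup>2) / 2)) \<le> p / (s * q) * (s / sqrt p)"
      by (rule mult_left_mono) (use pos in auto)
    also have "p / (s * q) * (s / sqrt p) = sqrt p / q"
    proof -
      have "p / (q * sqrt p) = (p / sqrt p) / q" by simp
      then show ?thesis using pos by (simp add: real_div_sqrt)
    qed
    finally have "sqrt D * (p / (s * q) * (e * (3/2 - e\<^sup>2 * (p / s\<^sup>2) / 2))) \<le> sqrt D * (sqrt p / q)"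
      by (rule mult_left_mono) (use D0 in auto)
    then show ?thesis unfolding L canon_integrand_def by (simp add: D_def p_def q_def)
  qed
  \<comment> \<open>Without integrability the integral would be 0 by convention. The majorant uses
    \<open>p \<le> s^2\<close>, which holds for \<open>m \<le> 1/3\<close>.\<close>
  have iG: "integrable lborel (canon_integrand m)"
  proof (rule Bochner_Integration.integrable_bound)
    show "integrable lborel (\<lambda>x. sqrt D * (?s x / ?q x))"
      using i1 by (intro integrable_mult_right) (rule integrable.intros)
    have "continuous_on UNIV (canon_integrand m)"
      unfolding canon_integrand_def using q0 by (intro continuous_intros) (use q0 in \<open>metis less_irrefl\<close>)
    then show "canon_integrand m \<in> borel_measurable lborel"
      by (simp add: borel_measurable_continuous_onI)
    have "norm (canon_integrand m x) \<le> norm (sqrt D * (?s x / ?q x))" for x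
    proof -
      have "6 * m * x\<^sup>2 \<le> 2 * x\<^sup>2" using m by (intro mult_right_mono) auto
      then have "?p x \<le> (?s x)\<^sup>2" by (simp add: power2_eq_square power4_eq_xxxx algebra_simps)
      then have "sqrt (?p x) \<le> ?s x" using s0[of x] by (intro real_le_lsqrt) auto
      moreover have "canon_integrand m x \<ge> 0"
        unfolding canon_integrand_def D_def[symmetric] using D0 p0[of x] q0[of x] by simp
      moreover have "canon_integrand m x \<le> sqrt D * (?s x / ?q x)" if "sqrt (?p x) \<le> ?s x"
        unfolding canon_integrand_def D_def[symmetric] times_divide_eq_right using D0 q0[of x] that
        by (intro divide_right_mono mult_left_mono) auto
      ultimately show ?thesis unfolding real_norm_def by linarith
    qed
    then show "AE x in lborel. norm (canon_integrand m x) \<le> norm (sqrt D * (?s x / ?q x))" by simp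
  qed
  have "sqrt D * (e * P) \<le> integral\<^sup>L lborel (canon_integrand m)"
    using integral_mono[OF _ iG LG] iL' by (auto simp: has_bochner_integral_iff)
  moreover have "pi * sqrt (8/3) < sqrt D * (e * P)"
  proof (rule power_less_imp_less_base)
    show "0 \<le> sqrt D * (e * P)" using D0 e0 P0 by simp
    have "(sqrt D * (e * P))\<^sup>2 = D * P^3 / Q"
    proof -
      have "(sqrt D * (e * P))\<^sup>2 = D * (P / Q * P\<^sup>2)"
        unfolding power_mult_distrib e2 using D0 by simp
      then show ?thesis by (simp add: power2_eq_square power3_eq_cube)
    qed
    moreover have "pi\<^sup>2 * (8/3) * Q < D * P^3"
    proof -
      define w where "w = (v - 2) / 2 + (1 + 3 / v\<^sup>2) / 8"
      \<comment> \<open>The root \<open>v = 3\<close> belongs to \<open>m = 1/3\<close>, where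
        \<open>p / s^2\<close> is constant and the tangent bound is exact.\<close>
      have "(v - 1) * (2 * v - 3) * (v - 3) > 0" using v3 by simp
      then have "4 * v\<^sup>2 * (v - 2) + v\<^sup>2 + 3 < 6 * (v - 1)^3"
        by (simp add: power2_eq_square power3_eq_cube algebra_simps)
      moreover have "8 * v\<^sup>2 * w = 4 * v\<^sup>2 * (v - 2) + v\<^sup>2 + 3"
        unfolding w_def using v3 by (simp add: field_simps power2_eq_square)
      ultimately have w: "8 * v\<^sup>2 * w < 6 * (v - 1)^3" by simp
      have Db: "D * b = 2 * (m * (1 - m))"
        unfolding D_def b_def using m by (simp add: field_simps power2_eq_square)
      have "v\<^sup>2 * (pi\<^sup>2 * (8/3) * Q) = b\<^sup>2 * pi^3 * (1 + 3 * m) / 3 * (8 * v\<^sup>2 * w)"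
        unfolding Q w_def[symmetric] by (simp add: power2_eq_square power3_eq_cube)
      also have "\<dots> < b\<^sup>2 * pi^3 * (1 + 3 * m) / 3 * (6 * (v - 1)^3)"
        by (rule mult_strict_left_mono[OF w]) (use b0 m in auto)
      also have "\<dots> = 2 * (m * (1 - m)) * v\<^sup>2 * (b\<^sup>2 * pi^3 * (v - 1)^3)"
        unfolding vm[symmetric] by (simp add: field_simps)
      also have "\<dots> = v\<^sup>2 * (D * P^3)"
        unfolding Db[symmetric] P by (simp add: power_mult_distrib power2_eq_square power3_eq_cube)
      finally show ?thesis using v3 by simp
    qed
    ultimately show "(pi * sqrt (8/3))\<^sup>2 < (sqrt D * (e * P))\<^sup>2"
      using Q0 by (simp add: power_mult_distrib pos_less_divide_eq)
  qed
  ultimately show ?thesis by simp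
qed

section \<open>Moebius invariance of the length\<close>

text \<open>Off its pole the map is injective and misses at most the one value \<open>a / c\<close>,
  so only null sets are lost. In the non-integrable case both integrals are 0, so the equality can
  be applied to \<open>speed\<close> without proving integrability first.\<close>

lemma lborel_integral_mobius:
  fixes h k :: "real \<Rightarrow> real"
  assumes \<Delta>: "a * d - b * c \<noteq> 0"
    and meas: "h \<in> borel_measurable borel" "k \<in> borel_measurable borel"
    and hk: "\<And>x. c * x + d \<noteq> 0 \<Longrightarrow> k x = \<bar>(a * d - b * c) / (c * x + d)\<^sup>2\<bar> * h ((a * x + b) / (c * x + d))"
  shows "integral\<^sup>L lborel k = integral\<^sup>L lborel h"
proof -
  define S where "S = {x. c * x + d \<noteq> 0}"
  define g where "g x = (a * x + b) / (c * x + d)" for x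
  have neg: "negligible {x::real. u * x + w = 0}" if "u \<noteq> 0 \<or> w \<noteq> 0" for u w
  proof (rule negligible_subset)
    show "{x. u * x + w = 0} \<subseteq> {- w / u}"
    proof
      fix x assume "x \<in> {x. u * x + w = 0}"
      then have e: "u * x + w = 0" by simp
      then have "u \<noteq> 0" using that by auto
      then show "x \<in> {- w / u}" using e by (simp add: eq_divide_eq mult.commute add_eq_0_iff)
    qed
  qed simp
  have cd: "c \<noteq> 0 \<or> d \<noteq> 0" and ac: "- c \<noteq> 0 \<or> a \<noteq> 0" using \<Delta> by auto
  have nS: "negligible (- S)" using neg[OF cd] by (simp add: S_def Compl_eq)
  have T: "g ` S = {y. - c * y + a \<noteq> 0}"
  proof (intro equalityI subsetI)
    fix y assume "y \<in> g ` S"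
    then obtain x where x: "c * x + d \<noteq> 0" "y = g x" by (auto simp: S_def)
    then have "y * (c * x + d) = a * x + b" by (simp add: g_def)
    then have "(- c * y + a) * (c * x + d) = a * d - b * c" by algebra
    then show "y \<in> {y. - c * y + a \<noteq> 0}" using \<Delta> by auto
  next
    fix y assume "y \<in> {y. - c * y + a \<noteq> 0}"
    then have y: "- c * y + a \<noteq> 0" by simp
    define x where "x = (d * y - b) / (- c * y + a)"
    have 1: "c * x + d = (a * d - b * c) / (- c * y + a)" using y by (simp add: x_def field_simps)
    have 2: "a * x + b = y * (a * d - b * c) / (- c * y + a)" using y by (simp add: x_def field_simps)
    have "x \<in> S" "g x = y" using 1 2 y \<Delta> by (auto simp: S_def g_def)
    then show "y \<in> g ` S" by blast
  qed
  have nT: "negligible (- g ` S)" unfolding T using neg[OF ac] by (simp add: Compl_eq)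
  have "open S" unfolding S_def by (intro open_Collect_neq continuous_intros)
  then have Sm: "S \<in> sets lebesgue" by simp
  have der: "(g has_field_derivative (a * d - b * c) / (c * x + d)\<^sup>2) (at x within S)" if "x \<in> S" for x
    unfolding g_def using that
    by (auto intro!: derivative_eq_intros simp: S_def power2_eq_square field_simps)
  have inj: "inj_on g S"
  proof (rule inj_onI)
    fix x y assume "x \<in> S" "y \<in> S" "g x = g y"
    then have "(a * x + b) * (c * y + d) = (a * y + b) * (c * x + d)"
      by (simp add: S_def g_def field_simps)
    then have "(a * d - b * c) * (x - y) = 0" by algebra
    then show "x = y" using \<Delta> by simp
  qed
  have "(\<lambda>x. \<bar>(a * d - b * c) / (c * x + d)\<^sup>2\<bar> * h (g x)) absolutely_integrable_on S \<longleftrightarrow> k absolutely_integrable_on S"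
    by (rule set_integrable_cong) (auto simp: S_def g_def hk)
  moreover have "integral S (\<lambda>x. \<bar>(a * d - b * c) / (c * x + d)\<^sup>2\<bar> * h (g x)) = integral S k"
    by (rule Henstock_Kurzweil_Integration.integral_cong) (auto simp: S_def g_def hk)
  ultimately have *: "k absolutely_integrable_on S \<and> integral S k = r \<longleftrightarrow>
      h absolutely_integrable_on g ` S \<and> integral (g ` S) h = r" for r
    using has_absolute_integral_change_of_variables_1'[OF Sm der inj, of h r] by simp
  have spike: "f absolutely_integrable_on U \<longleftrightarrow> f absolutely_integrable_on UNIV" "integral U f = integral UNIV f"
    if "negligible (- U)" for U and f :: "real \<Rightarrow> real"
  proof -
    have "negligible (U - UNIV \<union> (UNIV - U))" using that by (simp add: Compl_eq_Diff_UNIV)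
    then have n: "negligible {x \<in> U - UNIV. f x \<noteq> 0}" "negligible {x \<in> UNIV - U. f x \<noteq> 0}"
      by (auto intro: negligible_subset)
    show "f absolutely_integrable_on U \<longleftrightarrow> f absolutely_integrable_on UNIV"
      by (rule absolutely_integrable_spike_set_eq[OF n])
    show "integral U f = integral UNIV f" by (rule integral_spike_set[OF n])
  qed
  have **: "k absolutely_integrable_on UNIV \<and> integral UNIV k = r \<longleftrightarrow>
      h absolutely_integrable_on UNIV \<and> integral UNIV h = r" for r
    using *[of r] spike[OF nS, of k] spike[OF nT, of h] by simp
  have lb: "integrable lborel f \<longleftrightarrow> f absolutely_integrable_on UNIV"
     "f absolutely_integrable_on UNIV \<Longrightarrow> integral\<^sup>L lborel f = integral UNIV f"
    if "f \<in> borel_measurable borel" for f :: "real \<Rightarrow> real"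
  proof -
    show 1: "integrable lborel f \<longleftrightarrow> f absolutely_integrable_on UNIV"
      using that integrable_completion[of f lborel] by (simp add: set_integrable_def)
    assume "f absolutely_integrable_on UNIV"
    then show "integral\<^sup>L lborel f = integral UNIV f" using 1 by (simp add: integral_lborel)
  qed
  show ?thesis
  proof (cases "k absolutely_integrable_on UNIV")
    case True
    then show ?thesis using **[of "integral UNIV k"] lb(2)[OF meas(1)] lb(2)[OF meas(2)] by simp
  next
    case False
    then have "\<not> h absolutely_integrable_on UNIV" using **[of "integral UNIV h"] by blast
    then show ?thesis using False lb(1)[OF meas(1)] lb(1)[OF meas(2)]
      by (simp add: not_integrable_integral_eq)
  qed
qed

section \<open>Symmetric squares acting on the moment curve\<close>

definition veronese :: "real \<Rightarrow> real \<Rightarrow> real^3" where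
  "veronese x y = vector [y\<^sup>2, x * y, x\<^sup>2]"

text \<open>Paired with \<open>veronese u v\<close> it gives \<open>(x * v - y * u)^2\<close>;
  \<open>veronese_dual x 1\<close> is the cross product of \<open>fP x\<close> and
  \<open>gP x\<close>.\<close>

definition veronese_dual :: "real \<Rightarrow> real \<Rightarrow> real^3" where
  "veronese_dual x y = vector [x\<^sup>2, - 2 * x * y, y\<^sup>2]"

text \<open>The symmetric square of the 2x2 matrix with rows \<open>(a, b)\<close> and
  \<open>(c, d)\<close>, in the basis of \<open>veronese\<close>.\<close>

definition sym2 :: "real \<Rightarrow> real \<Rightarrow> real \<Rightarrow> real \<Rightarrow> real^3^3" where
  "sym2 a b c d = vector [vector [d\<^sup>2, 2 * c * d, c\<^sup>2], vector [b * d, a * d + b * c, a * c],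
     vector [b\<^sup>2, 2 * a * b, a\<^sup>2]]"

definition bil :: "real^3^3 \<Rightarrow> real^3 \<Rightarrow> real^3 \<Rightarrow> real" where
  "bil M u v = u \<bullet> (M *v v)"

lemmas mat3_simps = vec_eq_iff forall_3 sum_3 inner_vec_def matrix_vector_mult_def
  matrix_matrix_mult_def transpose_def mat_def

lemma bil_congruence: "bil (transpose R ** M ** R) u v = bil M (R *v u) (R *v v)"
  unfolding bil_def
  by (metis dot_lmul_matrix matrix_vector_mul_assoc vector_transpose_matrix inner_commute transpose_matrix_vector)

lemma bil_add_left: "bil M (u + v) w = bil M u w + bil M v w"
  and bil_add_right: "bil M w (u + v) = bil M w u + bil M w v"
  and bil_scale_left: "bil M (r *\<^sub>R u) w = r * bil M u w"
  and bil_scale_right: "bil M w (r *\<^sub>R u) = r * bil M w u"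
  by (simp_all add: bil_def inner_add_left inner_add_right matrix_vector_right_distrib matrix_vector_mult_scaleR)

lemma bil_commute:
  assumes "transpose M = M" shows "bil M u v = bil M v u"
  unfolding bil_def using assms
  by (metis dot_lmul_matrix inner_commute transpose_matrix_vector)

lemma sym2_veronese: "sym2 a b c d *v veronese x y = veronese (a * x + b * y) (c * x + d * y)"
  by (simp add: sym2_def veronese_def mat3_simps power2_eq_square algebra_simps)

text \<open>The pairing of \<open>veronese_dual\<close> with \<open>veronese\<close> is the square
  of a 2x2 determinant, so a linear change of both arguments multiplies it by the square of its own
  determinant.\<close>

lemma sym2_veronese_dual:
  "transpose (sym2 a b c d) *v veronese_dual (a * x + b * y) (c * x + d * y) = (a * d - b * c)\<^sup>2 *\<^sub>R veronese_dual x y"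
  by (simp add: sym2_def veronese_dual_def mat3_simps power2_eq_square algebra_simps)

lemma det_sym2: "det (sym2 a b c d) = (a * d - b * c)^3"
  by (simp add: sym2_def det_3 power2_eq_square power3_eq_cube algebra_simps)

lemma fP_veronese: "fP x = veronese x 1"
  by (simp add: fP_def veronese_def)

lemma gP_eq: "gP x = vector [0, 1, 2 * x]"
proof -
  have "(fP has_vector_derivative vector [0, 1, 2 * x]) (at x)"
    unfolding fP_def has_vector_derivative_def
  proof (subst has_derivative_componentwise_within, intro ballI)
    fix i :: "real^3" assume "i \<in> Basis"
    then obtain j where j: "i = axis j 1" by (auto simp: Basis_vec_def)
    show "((\<lambda>x. vector [1, x, x\<^sup>2] \<bullet> i) has_derivative (\<lambda>y. (y *\<^sub>R vector [0, 1, 2 * x]) \<bullet> i)) (at x)"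
    proof -
      have "((\<lambda>x::real. x\<^sup>2) has_derivative (\<lambda>y. y * (2 * x))) (at x)"
        by (auto intro!: derivative_eq_intros)
      then show ?thesis
        using exhaust_3[of j] unfolding j by (auto simp: inner_axis)
    qed
  qed
  then show ?thesis unfolding gP_def by (rule vector_derivative_at)
qed

lemma sym2_fP:
  assumes "c * x + d \<noteq> 0"
  shows "sym2 a b c d *v fP x = (c * x + d)\<^sup>2 *\<^sub>R fP ((a * x + b) / (c * x + d))"
proof -
  have "sym2 a b c d *v fP x = veronese (a * x + b) (c * x + d)" by (simp add: fP_veronese sym2_veronese)
  also have "\<dots> = (c * x + d)\<^sup>2 *\<^sub>R fP ((a * x + b) / (c * x + d))"
    using assms by (simp add: fP_veronese veronese_def mat3_simps power_divide power2_eq_square)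
  finally show ?thesis .
qed

text \<open>This is the derivative of \<open>sym2_fP\<close> by the product and chain rules. The
  component along \<open>fP\<close> drops out of the Gram determinant.\<close>

lemma sym2_gP:
  assumes "c * x + d \<noteq> 0"
  shows "sym2 a b c d *v gP x = (2 * c * (c * x + d)) *\<^sub>R fP ((a * x + b) / (c * x + d))
     + (a * d - b * c) *\<^sub>R gP ((a * x + b) / (c * x + d))"
  using assms unfolding gP_eq fP_veronese sym2_def veronese_def
  by (simp add: mat3_simps divide_simps, algebra)

text \<open>For positive definite \<Sigma>, with the inner product given by \<Sigma>, this is the
  speed of the curve \<open>fP\<close> after projection to the unit sphere.\<close>

definition speed :: "real^3^3 \<Rightarrow> real \<Rightarrow> real" where
  "speed \<Sigma> x = sqrt (bil \<Sigma> (fP x) (fP x) * bil \<Sigma> (gP x) (gP x) - (bil \<Sigma> (fP x) (gP x))\<^sup>2)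
     / bil \<Sigma> (fP x) (fP x)"

lemma Vol1_speed: "Vol1 \<Sigma> = 2 * integral\<^sup>L lborel (speed \<Sigma>)"
proof -
  have "(\<lambda>x. sqrt ((fP x \<bullet> (\<Sigma> *v fP x)) * (gP x \<bullet> (\<Sigma> *v gP x)) - (fP x \<bullet> (\<Sigma> *v gP x))\<^sup>2)
     / (fP x \<bullet> (\<Sigma> *v fP x))) = speed \<Sigma>"
    unfolding speed_def bil_def by simp
  then show ?thesis unfolding Vol1_def by (simp only:)
qed

text \<open>Scalar factors do not change the projected curve, so the linear map only reparametrises
  it; the factor is the absolute derivative of the Moebius map.\<close>

lemma speed_mobius:
  assumes sym: "transpose \<Sigma> = \<Sigma>" and x: "c * x + d \<noteq> 0"
  shows "speed (transpose (sym2 a b c d) ** \<Sigma> ** sym2 a b c d) x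
     = \<bar>(a * d - b * c) / (c * x + d)\<^sup>2\<bar> * speed \<Sigma> ((a * x + b) / (c * x + d))"
proof -
  let ?y = "(a * x + b) / (c * x + d)"
  define l where "l = c * x + d"
  define \<Delta> where "\<Delta> = a * d - b * c"
  define B where "B u v = bil \<Sigma> u v" for u v
  have l0: "l \<noteq> 0" using x by (simp add: l_def)
  define F G H where "F = B (fP ?y) (fP ?y)" and "G = B (gP ?y) (gP ?y)" and "H = B (fP ?y) (gP ?y)"
  have H': "B (gP ?y) (fP ?y) = H" using bil_commute[OF sym] by (simp add: B_def H_def)
  have B1: "B (fP ((a * x + b) / l)) (fP ((a * x + b) / l)) = F" "B (gP ((a * x + b) / l)) (gP ((a * x + b) / l)) = G"
    "B (fP ((a * x + b) / l)) (gP ((a * x + b) / l)) = H" "B (gP ((a * x + b) / l)) (fP ((a * x + b) / l)) = H"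
    using H' by (simp_all add: F_def G_def H_def l_def)
  have "speed (transpose (sym2 a b c d) ** \<Sigma> ** sym2 a b c d) x
    = sqrt (l\<^sup>2 * (l\<^sup>2 * F) * ((2*c*l) * ((2*c*l) * F + \<Delta> * H) + \<Delta> * ((2*c*l) * H + \<Delta> * G))
        - ((2*c*l) * (l\<^sup>2 * F) + \<Delta> * (l\<^sup>2 * H))\<^sup>2) / (l\<^sup>2 * (l\<^sup>2 * F))"
    unfolding speed_def bil_congruence sym2_fP[OF x] sym2_gP[OF x]
    unfolding bil_add_left bil_add_right bil_scale_left bil_scale_right
    unfolding l_def[symmetric] \<Delta>_def[symmetric] B_def[symmetric]
    unfolding B1 ..
  also have "l\<^sup>2 * (l\<^sup>2 * F) * ((2*c*l) * ((2*c*l) * F + \<Delta> * H) + \<Delta> * ((2*c*l) * H + \<Delta> * G))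
        - ((2*c*l) * (l\<^sup>2 * F) + \<Delta> * (l\<^sup>2 * H))\<^sup>2 = (l\<^sup>2 * \<Delta>)\<^sup>2 * (F * G - H\<^sup>2)"
    by algebra
  also have "sqrt ((l\<^sup>2 * \<Delta>)\<^sup>2 * (F * G - H\<^sup>2)) / (l\<^sup>2 * (l\<^sup>2 * F)) = \<bar>\<Delta> / l\<^sup>2\<bar> * (sqrt (F * G - H\<^sup>2) / F)"
  proof -
    have *: "z * D * s / (z * (z * F)) = D / z * (s / F)" if "z \<noteq> 0" for z D s :: real
      using that by simp
    have "sqrt ((l\<^sup>2 * \<Delta>)\<^sup>2 * (F * G - H\<^sup>2)) = l\<^sup>2 * \<bar>\<Delta>\<bar> * sqrt (F * G - H\<^sup>2)"
      by (simp add: real_sqrt_mult abs_mult)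
    moreover have "\<bar>\<Delta> / l\<^sup>2\<bar> = \<bar>\<Delta>\<bar> / l\<^sup>2" by (simp add: abs_divide)
    ultimately show ?thesis using *[of "l\<^sup>2"] l0 by simp
  qed
  finally show ?thesis
    by (simp add: speed_def F_def G_def H_def l_def \<Delta>_def B_def)
qed

lemma speed_measurable: "speed \<Sigma> \<in> borel_measurable borel"
  unfolding speed_def bil_def gP_eq fP_def
  by (simp add: mat3_simps)

lemma Vol1_congruence_sym2:
  assumes "transpose \<Sigma> = \<Sigma>" "a * d - b * c \<noteq> 0"
  shows "Vol1 (transpose (sym2 a b c d) ** \<Sigma> ** sym2 a b c d) = Vol1 \<Sigma>"
  unfolding Vol1_speed
  using lborel_integral_mobius[OF assms(2) speed_measurable[of \<Sigma>] speed_measurable speed_mobius[OF assms(1)]]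
  by simp

section \<open>Invariance of the length for inverse matrices\<close>

lemma matrix_inv_unique:
  fixes A B :: "real^'n^'n"
  assumes "A ** B = mat 1"
  shows "matrix_inv A = B"
proof -
  have BA: "B ** A = mat 1" using assms by (simp add: matrix_left_right_inverse)
  then have "invertible A" using assms by (auto simp: invertible_def)
  then have "A ** matrix_inv A = mat 1"
    unfolding invertible_def matrix_inv_def by (rule someI2_ex) simp
  then show ?thesis by (metis BA matrix_mul_assoc matrix_mul_lid matrix_mul_rid)
qed

lemma matrix_inv_right_real:
  fixes A :: "real^'n^'n"
  assumes "invertible A" shows "A ** matrix_inv A = mat 1"
  using assms matrix_inv_unique unfolding invertible_def by metis

text \<open>Inversion reverses the direction of the congruence: the inverse of \<open>M\<close> is
  \<open>transpose R ** N ** R\<close>, with \<open>N\<close> the inverse of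
  \<open>R ** M ** transpose R\<close>. This is the form needed in
  \<open>Vol1_congruence_sym2\<close>.\<close>

lemma Vol1_inv_congruence:
  fixes M :: "real^3^3"
  assumes sym: "transpose M = M" and inv: "invertible M" and \<Delta>: "a * d - b * c \<noteq> 0"
  shows "Vol1 (matrix_inv (sym2 a b c d ** M ** transpose (sym2 a b c d))) = Vol1 (matrix_inv M)"
proof -
  let ?R = "sym2 a b c d"
  let ?M' = "?R ** M ** transpose ?R"
  define N where "N = matrix_inv ?M'"
  have R: "invertible ?R" using \<Delta> by (simp add: invertible_det_nz det_sym2)
  then have R': "invertible (transpose ?R)" by (simp add: invertible_det_nz)
  have "invertible ?M'" by (intro invertible_mult R R' inv)
  then have MN: "?M' ** N = mat 1" unfolding N_def by (rule matrix_inv_right_real)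
  then have NM: "N ** ?M' = mat 1" by (simp add: matrix_left_right_inverse)
  have symM': "transpose ?M' = ?M'"
    by (simp add: matrix_transpose_mul sym matrix_mul_assoc)
  have symN: "transpose N = N"
  proof -
    have "transpose N ** ?M' = mat 1" using MN symM' by (metis matrix_transpose_mul transpose_mat)
    then show ?thesis using MN by (metis matrix_mul_assoc matrix_mul_lid matrix_mul_rid)
  qed
  obtain Q where Q: "transpose ?R ** Q = mat 1" using R' unfolding invertible_def by blast
  have "transpose ?R ** N ** ?R ** M = (transpose ?R ** (N ** ?M')) ** Q"
  proof -
    have "transpose ?R ** N ** ?R ** M = transpose ?R ** N ** ?R ** M ** (transpose ?R ** Q)" by (simp add: Q)
    then show ?thesis by (simp only: matrix_mul_assoc)
  qed
  then have "transpose ?R ** N ** ?R ** M = mat 1" using NM Q by simp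
  then have "M ** (transpose ?R ** N ** ?R) = mat 1" by (simp add: matrix_left_right_inverse)
  then have "matrix_inv M = transpose ?R ** N ** ?R" by (rule matrix_inv_unique)
  then show ?thesis using Vol1_congruence_sym2[OF symN \<Delta>] N_def by simp
qed

section \<open>Normal form of positive definite Hankel matrices\<close>

definition hankel :: "real^3^3 \<Rightarrow> bool" where
  "hankel M \<longleftrightarrow> M$2$1 = M$1$2 \<and> M$1$3 = M$2$2 \<and> M$3$1 = M$2$2 \<and> M$3$2 = M$2$3"

definition posdef :: "real^3^3 \<Rightarrow> bool" where
  "posdef M \<longleftrightarrow> (\<forall>c. c \<noteq> 0 \<longrightarrow> bil M c c > 0)"

text \<open>For \<open>M = \<Sum>\<^sub>i \<tau>\<^sub>i v\<^sub>i v\<^sub>i\<^sup>T\<close> with \<open>v\<^sub>i = veronese x\<^sub>i y\<^sub>i\<close> this is the quartic \<open>\<Sum>\<^sub>i \<tau>\<^sub>i (x y\<^sub>i - y x\<^sub>i)\<^sup>4\<close>.\<close>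

definition dual_form :: "real^3^3 \<Rightarrow> real \<Rightarrow> real \<Rightarrow> real" where
  "dual_form M x y = bil M (veronese_dual x y) (veronese_dual x y)"

text \<open>A quadratic form whose square at \<open>y = 1\<close> is \<open>sigmaP2\<close>.\<close>

definition sqnorm :: "real \<Rightarrow> real \<Rightarrow> real \<Rightarrow> real \<Rightarrow> real \<Rightarrow> real \<Rightarrow> real" where
  "sqnorm a b c d x y = (a * x + b * y)\<^sup>2 + (c * x + d * y)\<^sup>2"

text \<open>The Hankel matrix whose quartic is
  \<open>k * (x^4 + 6 * m * x^2 * y^2 + y^4)\<close>.\<close>

definition canon_mat :: "real \<Rightarrow> real \<Rightarrow> real^3^3" where
  "canon_mat k m = vector [vector [k, 0, k * m], vector [0, k * m, 0], vector [k * m, 0, k]]"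

lemma linear_system_solve:
  fixes a b c d :: real
  assumes "a * d - b * c \<noteq> 0"
  obtains x y where "a * x + b * y = u" "c * x + d * y = w"
proof
  let ?D = "a * d - b * c"
  have "a * ((d * u - b * w) / ?D) + b * ((a * w - c * u) / ?D) = (?D * u) / ?D"
    by (simp add: add_divide_distrib[symmetric] diff_divide_distrib[symmetric] algebra_simps)
  then show "a * ((d * u - b * w) / ?D) + b * ((a * w - c * u) / ?D) = u" using assms by simp
  have "c * ((d * u - b * w) / ?D) + d * ((a * w - c * u) / ?D) = (?D * w) / ?D"
    by (simp add: add_divide_distrib[symmetric] diff_divide_distrib[symmetric] algebra_simps)
  then show "c * ((d * u - b * w) / ?D) + d * ((a * w - c * u) / ?D) = w" using assms by simp
qed

lemma dual_form_hankel:
  assumes "hankel M"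
  shows "dual_form M x y = M$1$1 * x^4 - 4 * M$1$2 * x^3 * y + 6 * M$2$2 * x\<^sup>2 * y\<^sup>2
     - 4 * M$2$3 * x * y^3 + M$3$3 * y^4"
  using assms unfolding hankel_def dual_form_def bil_def veronese_dual_def
  by (simp add: mat3_simps power2_eq_square power3_eq_cube power4_eq_xxxx algebra_simps)

text \<open>The five free entries are, up to binomial factors and signs, the coefficients of the
  quartic, which values at five projective points determine.\<close>

lemma hankel_eqI:
  assumes "hankel M" "hankel N" "\<And>x y. dual_form M x y = dual_form N x y"
  shows "M = N"
proof -
  note e = assms(3)[unfolded dual_form_hankel[OF assms(1)] dual_form_hankel[OF assms(2)]]
  have "M$1$1 = N$1$1" "M$3$3 = N$3$3" using e[of 1 0] e[of 0 1] by simp_all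
  moreover have "M$1$2 = N$1$2" "M$2$2 = N$2$2" "M$2$3 = N$2$3"
    using e[of 1 1] e[of 1 "-1"] e[of 2 1] calculation by simp_all
  ultimately show ?thesis using assms(1,2) by (simp add: hankel_def vec_eq_iff forall_3)
qed

lemma hankel_symmetric: "hankel M \<Longrightarrow> transpose M = M"
  by (simp add: hankel_def mat3_simps)

lemma hankel_congruence:
  assumes "hankel M" shows "hankel (sym2 a b c d ** M ** transpose (sym2 a b c d))"
  using assms unfolding hankel_def sym2_def
  by (simp add: mat3_simps power2_eq_square algebra_simps)

lemma hankel_canon_mat: "hankel (canon_mat k m)"
  by (simp add: hankel_def canon_mat_def)

lemma dual_form_canon_mat: "dual_form (canon_mat k m) x y = k * (x^4 + 6 * m * x\<^sup>2 * y\<^sup>2 + y^4)"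
  unfolding dual_form_hankel[OF hankel_canon_mat] by (simp add: canon_mat_def algebra_simps)

lemma bil_congruence': "bil (R ** M ** transpose R) u v = bil M (transpose R *v u) (transpose R *v v)"
  using bil_congruence[of "transpose R" M u v] by simp

lemma dual_form_congruence:
  "dual_form (sym2 a b c d ** M ** transpose (sym2 a b c d)) (a * x + b * y) (c * x + d * y)
     = (a * d - b * c)^4 * dual_form M x y"
  unfolding dual_form_def bil_congruence' sym2_veronese_dual bil_scale_left bil_scale_right
  by (simp add: power2_eq_square power4_eq_xxxx)

lemma posdef_congruence:
  assumes "posdef M" "a * d - b * c \<noteq> 0"
  shows "posdef (sym2 a b c d ** M ** transpose (sym2 a b c d))"
  unfolding posdef_def
proof (intro allI impI)
  fix v :: "real^3" assume v: "v \<noteq> 0"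
  have "invertible (transpose (sym2 a b c d))"
    using assms(2) by (simp add: invertible_det_nz det_sym2)
  then have "transpose (sym2 a b c d) *v v \<noteq> 0"
    using v by (metis invertible_left_inverse matrix_left_invertible_ker)
  then show "bil (sym2 a b c d ** M ** transpose (sym2 a b c d)) v v > 0"
    unfolding bil_congruence' using assms(1) by (simp add: posdef_def)
qed

lemma posdef_invertible:
  assumes "posdef M" shows "invertible M"
proof -
  have "\<forall>x. M *v x = 0 \<longrightarrow> x = 0"
    using assms unfolding posdef_def bil_def by (metis inner_zero_right less_irrefl)
  then show ?thesis by (simp add: invertible_left_inverse matrix_left_invertible_ker)
qed

lemma posdef_dual_form:
  assumes "posdef M" "x \<noteq> 0 \<or> y \<noteq> 0" shows "dual_form M x y > 0"
proof -
  have "veronese_dual x y \<noteq> 0" using assms(2) by (auto simp: veronese_dual_def vec_eq_iff forall_3)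
  then show ?thesis using assms(1) by (simp add: dual_form_def posdef_def)
qed

lemma Vol1_inv_canon_mat:
  assumes k: "k > 0" and m: "0 < m" "m < 1"
  shows "Vol1 (matrix_inv (canon_mat k m)) = 2 * integral\<^sup>L lborel (canon_integrand m)"
proof -
  define D where "D = m * (1 - m\<^sup>2)"
  have "m * m < 1 * 1" by (rule mult_strict_mono) (use m in auto)
  then have D: "D > 0" using m by (simp add: D_def power2_eq_square)
  \<comment> \<open>\<open>N\<close> is the adjugate of \<open>canon_mat 1 m\<close> and
    \<open>D\<close> is its determinant.\<close>
  define N :: "real^3^3" where "N = vector [vector [m, 0, - m\<^sup>2], vector [0, 1 - m\<^sup>2, 0], vector [- m\<^sup>2, 0, m]]"
  define S where "S = (1 / (k * D)) *\<^sub>R N"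
  have "canon_mat k m ** N = (k * D) *\<^sub>R mat 1"
    by (simp add: canon_mat_def N_def D_def mat3_simps power2_eq_square algebra_simps)
  moreover have "canon_mat k m ** S = (1 / (k * D)) *\<^sub>R (canon_mat k m ** N)"
    by (simp add: S_def mat3_simps algebra_simps)
  ultimately have "canon_mat k m ** S = mat 1" using k D by simp
  then have inv: "matrix_inv (canon_mat k m) = S" by (rule matrix_inv_unique)
  have bS: "bil S u v = bil N u v / (k * D)" for u v
    by (simp add: S_def bil_def scaleR_matrix_vector_assoc[symmetric])
  have "speed S x = canon_integrand m x" for x
  proof -
    define q p where "q = m * x^4 + (1 - 3 * m\<^sup>2) * x\<^sup>2 + m" and "p = x^4 + 6 * m * x\<^sup>2 + 1"
    have 1: "bil N (fP x) (fP x) = q"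
      by (simp add: bil_def N_def fP_def q_def mat3_simps power2_eq_square power4_eq_xxxx algebra_simps)
    \<comment> \<open>The Gram determinant is the adjugate form of \<open>N\<close> at the cross
      product of \<open>fP x\<close> and \<open>gP x\<close>. That vector is
      \<open>veronese_dual x 1\<close> and the adjugate of \<open>N\<close> is \<open>D\<close>
      times \<open>canon_mat 1 m\<close>, so the quartic reappears.\<close>
    have 2: "bil N (fP x) (fP x) * bil N (gP x) (gP x) - (bil N (fP x) (gP x))\<^sup>2 = D * p"
      by (simp add: bil_def N_def fP_def gP_eq p_def D_def mat3_simps power2_eq_square power4_eq_xxxx algebra_simps)
    have "bil S (fP x) (fP x) * bil S (gP x) (gP x) - (bil S (fP x) (gP x))\<^sup>2 = D * p / (k * D)\<^sup>2"
      unfolding bS 2[symmetric] by (simp add: power2_eq_square diff_divide_distrib)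
    then have "speed S x = sqrt (D * p / (k * D)\<^sup>2) / (q / (k * D))"
      unfolding speed_def by (simp only:) (simp only: bS 1)
    also have "\<dots> = sqrt D * sqrt p / q"
      using k D by (simp add: real_sqrt_divide real_sqrt_mult)
    finally show ?thesis by (simp add: canon_integrand_def q_def p_def D_def)
  qed
  then have "speed S = canon_integrand m" by blast
  then show ?thesis unfolding inv Vol1_speed by simp
qed

section \<open>Normal forms of positive binary quartics\<close>

text \<open>Only the upper bound on \<open>m\<close> belongs to the quartic; the lower bound
  \<open>m > 0\<close> is obtained from the matrix in \<open>Vol1_inv_bound\<close>.\<close>

definition palindromic_equiv :: "(real \<Rightarrow> real \<Rightarrow> real) \<Rightarrow> bool" where
  "palindromic_equiv p \<longleftrightarrow> (\<exists>a b c d k m. a * d - b * c \<noteq> 0 \<and> k > 0 \<and> m \<le> 1/3 \<and>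
     (\<forall>x y. p x y = k * ((a*x+b*y)^4 + 6 * m * (a*x+b*y)\<^sup>2 * (c*x+d*y)\<^sup>2 + (c*x+d*y)^4)))"

lemma palindromic_equiv_linear:
  assumes "palindromic_equiv p" and \<Delta>: "a * d - b * c \<noteq> 0"
    and p: "\<And>x y. p' x y = p (a * x + b * y) (c * x + d * y)"
  shows "palindromic_equiv p'"
proof -
  obtain a1 b1 c1 d1 k m where 1: "a1 * d1 - b1 * c1 \<noteq> 0" "k > 0" "m \<le> 1/3"
    and e: "\<And>x y. p x y = k * ((a1*x+b1*y)^4 + 6 * m * (a1*x+b1*y)\<^sup>2 * (c1*x+d1*y)\<^sup>2 + (c1*x+d1*y)^4)"
    using assms(1) unfolding palindromic_equiv_def by metis
  have lin: "u * (a * x + b * y) + v * (c * x + d * y) = (u * a + v * c) * x + (u * b + v * d) * y" for u v x y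
    by (simp add: algebra_simps)
  have "(a1 * a + b1 * c) * (c1 * b + d1 * d) - (a1 * b + b1 * d) * (c1 * a + d1 * c)
      = (a1 * d1 - b1 * c1) * (a * d - b * c)" by (simp add: algebra_simps)
  then have "(a1 * a + b1 * c) * (c1 * b + d1 * d) - (a1 * b + b1 * d) * (c1 * a + d1 * c) \<noteq> 0"
    using 1 \<Delta> by simp
  moreover have "p' x y = k * (((a1 * a + b1 * c)*x+(a1 * b + b1 * d)*y)^4
      + 6 * m * ((a1 * a + b1 * c)*x+(a1 * b + b1 * d)*y)\<^sup>2 * ((c1 * a + d1 * c)*x+(c1 * b + d1 * d)*y)\<^sup>2
      + ((c1 * a + d1 * c)*x+(c1 * b + d1 * d)*y)^4)" for x y
    unfolding p e lin ..
  ultimately show ?thesis unfolding palindromic_equiv_def using 1(2,3) by blast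
qed

text \<open>Scaling \<open>x\<close> by \<mu> makes the product palindromic, with middle coefficient
  \<mu>\<open>^2 + 1/\<close>\<mu>\<open>^2 \<ge> 2\<close> relative to the outer ones, which is on
  the side \<open>m \<ge> 1/3\<close>. Passing to the sum and difference of the variables moves it
  to \<open>m \<le> 1/3\<close>, visible in \<open>m = (1 - 2 * v^2) / 3\<close>.\<close>

lemma palindromic_equiv_diagonal:
  assumes "l1 > 0" "l2 > 0"
  shows "palindromic_equiv (\<lambda>x y. (x\<^sup>2 + y\<^sup>2) * (l1 * x\<^sup>2 + l2 * y\<^sup>2))"
proof -
  define \<mu> where "\<mu> = sqrt (sqrt (l2 / l1))"
  have \<mu>0: "\<mu> > 0" using assms by (simp add: \<mu>_def)
  have "(\<mu>\<^sup>2)\<^sup>2 = l2 / l1" using assms by (simp add: \<mu>_def)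
  then have l2: "l2 = l1 * \<mu>^4" using assms by (simp add: field_simps)
  define v m k where "v = (\<mu>\<^sup>2 - 1) / (\<mu>\<^sup>2 + 1)" and "m = (1 - 2 * v\<^sup>2) / 3" and "k = l1 * \<mu>\<^sup>2 * (1 + \<mu>\<^sup>2)\<^sup>2"
  have s: "\<mu>\<^sup>2 + 1 > 0" by (simp add: add_nonneg_pos)
  have k0: "k > 0" using assms \<mu>0 s by (simp add: k_def add.commute)
  have vs: "v * (\<mu>\<^sup>2 + 1) = \<mu>\<^sup>2 - 1" using s by (simp add: v_def)
  have base: "palindromic_equiv (\<lambda>u w. k * (u^4 + 6 * m * u\<^sup>2 * w\<^sup>2 + w^4))"
    unfolding palindromic_equiv_def
    by (rule exI[of _ 1], rule exI[of _ 0], rule exI[of _ 0], rule exI[of _ 1], rule exI[of _ k], rule exI[of _ m])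
      (use k0 in \<open>simp add: m_def\<close>)
  show ?thesis
  proof (rule palindromic_equiv_linear[OF base, of "1 / (2 * \<mu>)" "- 1 / 2" "1 / 2" "1 / (2 * \<mu>)"])
    show "1 / (2 * \<mu>) * (- 1 / 2) - 1 / 2 * (1 / (2 * \<mu>)) \<noteq> 0" using \<mu>0 by simp
    fix x y :: real
    define u w where "u = 1 / (2 * \<mu>) * x + 1 / 2 * y" and "w = 1 / (2 * \<mu>) * x + - 1 / 2 * y"
    have x: "x = \<mu> * (u + w)" and y: "y = u - w" using \<mu>0 by (simp_all add: u_def w_def field_simps)
    have "(x\<^sup>2 + y\<^sup>2) * (l1 * x\<^sup>2 + l2 * y\<^sup>2)
      = l1 * \<mu>\<^sup>2 * (((\<mu>\<^sup>2 + 1) * (u\<^sup>2 + w\<^sup>2))\<^sup>2 - 4 * (\<mu>\<^sup>2 - 1)\<^sup>2 * u\<^sup>2 * w\<^sup>2)"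
      unfolding x y l2 by algebra
    also have "\<dots> = l1 * \<mu>\<^sup>2 * (((\<mu>\<^sup>2 + 1) * (u\<^sup>2 + w\<^sup>2))\<^sup>2 - 4 * (v * (\<mu>\<^sup>2 + 1))\<^sup>2 * u\<^sup>2 * w\<^sup>2)"
      unfolding vs ..
    also have "\<dots> = k * (u^4 + 6 * m * u\<^sup>2 * w\<^sup>2 + w^4)"
      unfolding k_def m_def by (simp add: field_simps) algebra
    finally show "(x\<^sup>2 + y\<^sup>2) * (l1 * x\<^sup>2 + l2 * y\<^sup>2) = k * ((1 / (2 * \<mu>) * x + 1 / 2 * y)^4
      + 6 * m * (1 / (2 * \<mu>) * x + 1 / 2 * y)\<^sup>2 * (1 / (2 * \<mu>) * x + - 1 / 2 * y)\<^sup>2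
      + (1 / (2 * \<mu>) * x + - 1 / 2 * y)^4)" unfolding u_def w_def .
  qed
qed

text \<open>A rotation fixes the first factor and diagonalises the second. Its angle is half the
  polar angle of \<open>(A - G, 2 * B)\<close>; \<open>off\<close> says that the mixed coefficient
  vanishes.\<close>

lemma palindromic_equiv_norm_times_quadratic:
  fixes A B G :: real
  assumes pos: "\<And>x y. x \<noteq> 0 \<or> y \<noteq> 0 \<Longrightarrow> A * x\<^sup>2 + 2 * B * x * y + G * y\<^sup>2 > 0"
  shows "palindromic_equiv (\<lambda>x y. (x\<^sup>2 + y\<^sup>2) * (A * x\<^sup>2 + 2 * B * x * y + G * y\<^sup>2))"
proof -
  obtain r t where r: "A - G = r * cos t" "2 * B = r * sin t" using polar_Ex by blast
  define C S where "C = cos (t/2)" and "S = sin (t/2)"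
  have CS: "C\<^sup>2 + S\<^sup>2 = 1" by (simp add: C_def S_def)
  have t: "cos t = C\<^sup>2 - S\<^sup>2" "sin t = 2 * S * C"
    using cos_double[of "t/2"] sin_double[of "t/2"] by (simp_all add: C_def S_def)
  have off: "B * (C\<^sup>2 - S\<^sup>2) = (A - G) * (S * C)" using r unfolding t by algebra
  define l1 l2 where "l1 = A * C\<^sup>2 + 2 * B * C * S + G * S\<^sup>2" and "l2 = A * (-S)\<^sup>2 + 2 * B * (-S) * C + G * C\<^sup>2"
  have nz: "C \<noteq> 0 \<or> S \<noteq> 0" using CS by auto
  have "l1 > 0" "l2 > 0" using pos[of C S] pos[of "-S" C] nz by (auto simp: l1_def l2_def)
  then have base: "palindromic_equiv (\<lambda>x y. (x\<^sup>2 + y\<^sup>2) * (l1 * x\<^sup>2 + l2 * y\<^sup>2))"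
    by (rule palindromic_equiv_diagonal)
  show ?thesis
  proof (rule palindromic_equiv_linear[OF base, of C C S "- S"])
    show "C * C - S * - S \<noteq> 0" using CS by (simp add: power2_eq_square)
    fix x y :: real
    have 1: "(C * x + S * y)\<^sup>2 + (- S * x + C * y)\<^sup>2 = x\<^sup>2 + y\<^sup>2"
      using CS by algebra
    have 2: "l1 * (C * x + S * y)\<^sup>2 + l2 * (- S * x + C * y)\<^sup>2 = A * x\<^sup>2 + 2 * B * x * y + G * y\<^sup>2"
      unfolding l1_def l2_def using CS off by algebra
    show "(x\<^sup>2 + y\<^sup>2) * (A * x\<^sup>2 + 2 * B * x * y + G * y\<^sup>2)
      = ((C * x + S * y)\<^sup>2 + (- S * x + C * y)\<^sup>2) * (l1 * (C * x + S * y)\<^sup>2 + l2 * (- S * x + C * y)\<^sup>2)"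
      unfolding 1 2 ..
  qed
qed

text \<open>A positive quartic has a complex root \<open>z\<close> off the real axis. Division by
  the real quadratic with roots \<open>z\<close> and its conjugate leaves a real linear remainder;
  it vanishes at the non-real \<open>z\<close>, so it is zero.\<close>

lemma positive_quartic_factor:
  fixes m0 m1 m2 m3 m4 :: real
  defines "p \<equiv> \<lambda>x y. m0 * x^4 - 4 * m1 * x^3 * y + 6 * m2 * x\<^sup>2 * y\<^sup>2 - 4 * m3 * x * y^3 + m4 * y^4"
  assumes pos: "\<And>x y. x \<noteq> 0 \<or> y \<noteq> 0 \<Longrightarrow> p x y > 0"
  shows "\<exists>x0 y0 A B G. y0 \<noteq> 0 \<and>
    (\<forall>x y. p x y = ((x - x0 * y)\<^sup>2 + (y0 * y)\<^sup>2) * (A * x\<^sup>2 + B * x * y + G * y\<^sup>2))"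
proof -
  define P :: "complex poly" where "P = [:of_real m4, of_real (-4 * m3), of_real (6 * m2), of_real (-4 * m1), of_real m0:]"
  have "m0 > 0" using pos[of 1 0] by (simp add: p_def)
  then have "degree P = 4" by (simp add: P_def)
  then have "\<not> constant (poly P)" by (simp add: constant_degree)
  then obtain z where z: "poly P z = 0" using fundamental_theorem_of_algebra by blast
  define x0 y0 where "x0 = Re z" and "y0 = Im z"
  have zxy: "z = of_real x0 + \<i> * of_real y0" by (simp add: x0_def y0_def complex_eq)
  have z': "of_real m0 * z^4 - 4 * of_real m1 * z^3 + 6 * of_real m2 * z\<^sup>2 - 4 * of_real m3 * z + of_real m4 = 0"
    using z unfolding P_def by (simp add: power2_eq_square power3_eq_cube power4_eq_xxxx algebra_simps)
  have y0: "y0 \<noteq> 0"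
  proof
    assume "y0 = 0"
    then have zr: "z = of_real x0" by (simp add: zxy)
    have "complex_of_real (p x0 1) = 0" using z' unfolding zr p_def by simp
    then show False using pos[of x0 1] by simp
  qed
  define n B G where "n = x0\<^sup>2 + y0\<^sup>2" and "B = 2 * x0 * m0 - 4 * m1" and "G = 6 * m2 + 2 * x0 * B - n * m0"
  define r1 r0 where "r1 = - 4 * m3 + 2 * x0 * G - n * B" and "r0 = m4 - n * G"
  have id: "m0 * x^4 - 4 * m1 * x^3 * y + 6 * m2 * x\<^sup>2 * y\<^sup>2 - 4 * m3 * x * y^3 + m4 * y^4
    = (x\<^sup>2 - 2 * x0 * x * y + n * y\<^sup>2) * (m0 * x\<^sup>2 + B * x * y + G * y\<^sup>2) + r1 * x * y^3 + r0 * y^4" for x y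
    unfolding r1_def r0_def G_def B_def by algebra
  have "z\<^sup>2 - 2 * of_real x0 * z + of_real n = 0"
    unfolding zxy n_def by (simp add: power2_eq_square algebra_simps)
  moreover have "of_real m0 * z^4 - 4 * of_real m1 * z^3 + 6 * of_real m2 * z\<^sup>2 - 4 * of_real m3 * z + of_real m4
     = (z\<^sup>2 - 2 * of_real x0 * z + of_real n) * (of_real m0 * z\<^sup>2 + of_real B * z + of_real G) + of_real r1 * z + of_real r0"
    unfolding r1_def r0_def G_def B_def
    by (simp add: power2_eq_square power3_eq_cube power4_eq_xxxx algebra_simps)
  ultimately have r: "of_real r1 * z + of_real r0 = 0" using z' by simp
  have "Im (of_real r1 * z + of_real r0) = r1 * y0" by (simp add: y0_def)
  then have r1: "r1 = 0" using r y0 by simp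
  then have r0: "r0 = 0" using r by simp
  have "p x y = ((x - x0 * y)\<^sup>2 + (y0 * y)\<^sup>2) * (m0 * x\<^sup>2 + B * x * y + G * y\<^sup>2)" for x y
    unfolding p_def id r1 r0 n_def by algebra
  then show ?thesis using y0 by blast
qed

lemma palindromic_equiv_dual_form:
  assumes H: "hankel M" and pd: "posdef M"
  shows "palindromic_equiv (dual_form M)"
proof -
  note p = dual_form_hankel[OF H]
  let ?p = "\<lambda>x y. M$1$1 * x^4 - 4 * M$1$2 * x^3 * y + 6 * M$2$2 * x\<^sup>2 * y\<^sup>2 - 4 * M$2$3 * x * y^3 + M$3$3 * y^4"
  have pos: "?p x y > 0" if "x \<noteq> 0 \<or> y \<noteq> 0" for x y
    using posdef_dual_form[OF pd that] unfolding p .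
  obtain x0 y0 A B G where y0: "y0 \<noteq> 0"
    and f0: "\<And>x y. ?p x y = ((x - x0 * y)\<^sup>2 + (y0 * y)\<^sup>2) * (A * x\<^sup>2 + B * x * y + G * y\<^sup>2)"
    using positive_quartic_factor[OF pos] by auto
  note f = f0[folded p]
  \<comment> \<open>These constants invert the substitution \<open>u = x - x0 * y\<close>,
    \<open>w = y0 * y\<close>, which turns the first factor into \<open>u^2 + w^2\<close>.\<close>
  define x1 y1 where "x1 = x0 / y0" and "y1 = 1 / y0"
  have e: "y0 * y1 = 1" "x1 = x0 * y1" using y0 by (simp_all add: x1_def y1_def)
  define B' G' where "B' = (2 * A * x1 + B * y1) / 2" and "G' = A * x1\<^sup>2 + B * x1 * y1 + G * y1\<^sup>2"
  have Q: "A * u\<^sup>2 + 2 * B' * u * w + G' * w\<^sup>2 = A * (u + x1 * w)\<^sup>2 + B * (u + x1 * w) * (y1 * w) + G * (y1 * w)\<^sup>2" for u w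
    unfolding B'_def G'_def by (simp add: power2_eq_square field_simps)
  have f': "dual_form M (u + x1 * w) (y1 * w) = (u\<^sup>2 + w\<^sup>2) * (A * u\<^sup>2 + 2 * B' * u * w + G' * w\<^sup>2)" for u w
  proof -
    have "u + x1 * w - x0 * (y1 * w) = u" "y0 * (y1 * w) = w" using e by (simp, metis mult.assoc mult_1)
    then show ?thesis unfolding f Q by (simp only:)
  qed
  have base: "palindromic_equiv (\<lambda>u w. (u\<^sup>2 + w\<^sup>2) * (A * u\<^sup>2 + 2 * B' * u * w + G' * w\<^sup>2))"
  proof (rule palindromic_equiv_norm_times_quadratic)
    fix u w :: real assume uw: "u \<noteq> 0 \<or> w \<noteq> 0"
    then have "u + x1 * w \<noteq> 0 \<or> y1 * w \<noteq> 0" using e by (cases "w = 0") auto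
    then have "(u\<^sup>2 + w\<^sup>2) * (A * u\<^sup>2 + 2 * B' * u * w + G' * w\<^sup>2) > 0"
      unfolding f'[symmetric] by (rule posdef_dual_form[OF pd])
    moreover have "u\<^sup>2 + w\<^sup>2 > 0" using uw by (simp add: sum_power2_gt_zero_iff)
    ultimately show "A * u\<^sup>2 + 2 * B' * u * w + G' * w\<^sup>2 > 0" by (simp add: zero_less_mult_iff)
  qed
  show ?thesis
  proof (rule palindromic_equiv_linear[OF base, of 1 y0 "- x0" 0])
    show "1 * y0 - - x0 * 0 \<noteq> 0" using y0 by simp
    fix x y :: real
    have "(1 * x + - x0 * y) + x1 * (0 * x + y0 * y) = x" using e by algebra
    moreover have "y1 * (0 * x + y0 * y) = y" using e by algebra
    ultimately show "dual_form M x y = ((1 * x + - x0 * y)\<^sup>2 + (0 * x + y0 * y)\<^sup>2) *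
      (A * (1 * x + - x0 * y)\<^sup>2 + 2 * B' * (1 * x + - x0 * y) * (0 * x + y0 * y) + G' * (0 * x + y0 * y)\<^sup>2)"
      unfolding f'[symmetric] by (simp only:)
  qed
qed

section \<open>Lower bound for the length and the case of equality\<close>

lemma congruence_canon_mat:
  assumes H: "hankel M" and \<Delta>: "a * d - b * c \<noteq> 0"
    and e: "\<And>x y. dual_form M x y = k * ((a*x+b*y)^4 + 6 * m * (a*x+b*y)\<^sup>2 * (c*x+d*y)\<^sup>2 + (c*x+d*y)^4)"
  shows "sym2 a b c d ** M ** transpose (sym2 a b c d) = canon_mat ((a * d - b * c)^4 * k) m"
proof (rule hankel_eqI[OF hankel_congruence[OF H] hankel_canon_mat])
  fix u w
  obtain x y where xy: "a * x + b * y = u" "c * x + d * y = w" using linear_system_solve[OF \<Delta>] by blast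
  show "dual_form (sym2 a b c d ** M ** transpose (sym2 a b c d)) u w
      = dual_form (canon_mat ((a * d - b * c)^4 * k) m) u w"
    using dual_form_congruence[of a b c d M x y] e[of x y] unfolding xy dual_form_canon_mat by simp
qed

lemma square_dual_form:
  assumes H: "hankel M" and \<Delta>: "a * d - b * c \<noteq> 0" and k: "k > 0"
    and e: "\<And>x y. dual_form M x y = k * (sqnorm a b c d x y)\<^sup>2"
  shows "sym2 a b c d ** M ** transpose (sym2 a b c d) = canon_mat ((a * d - b * c)^4 * k) (1/3)"
    and "invertible M" and "Vol1 (matrix_inv M) = 2 * (pi * sqrt (8/3))"
proof -
  let ?R = "sym2 a b c d"
  have "(sqnorm a b c d x y)\<^sup>2 = (a*x+b*y)^4 + 6 * (1/3) * (a*x+b*y)\<^sup>2 * (c*x+d*y)\<^sup>2 + (c*x+d*y)^4" for x y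
    unfolding sqnorm_def by algebra
  then show c: "?R ** M ** transpose ?R = canon_mat ((a * d - b * c)^4 * k) (1/3)"
    using e by (intro congruence_canon_mat[OF H \<Delta>]) simp
  have k': "(a * d - b * c)^4 * k > 0" using \<Delta> k by simp
  have detK: "det (canon_mat K (1/3)) = K^3 * (8/27)" for K
    by (simp add: canon_mat_def det_3 power3_eq_cube)
  then have "det (?R ** M ** transpose ?R) \<noteq> 0" unfolding c detK using \<Delta> k by simp
  then show inv: "invertible M" by (auto simp: det_mul invertible_det_nz)
  show "Vol1 (matrix_inv M) = 2 * (pi * sqrt (8/3))"
    using Vol1_inv_congruence[OF hankel_symmetric[OF H] inv \<Delta>] Vol1_inv_canon_mat[OF k', of "1/3"]
      canon_integrand_third unfolding c by (simp add: has_bochner_integral_iff)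
qed

lemma Vol1_inv_bound:
  assumes H: "hankel M" and pd: "posdef M"
  shows "Vol1 (matrix_inv M) \<ge> 2 * (pi * sqrt (8/3))"
    and "Vol1 (matrix_inv M) = 2 * (pi * sqrt (8/3)) \<Longrightarrow>
      \<exists>a b c d k. a * d - b * c \<noteq> 0 \<and> k > 0 \<and> (\<forall>x y. dual_form M x y = k * (sqnorm a b c d x y)\<^sup>2)"
proof -
  obtain a b c d k m where \<Delta>: "a * d - b * c \<noteq> 0" and k: "k > 0" and m: "m \<le> 1/3"
    and e: "\<And>x y. dual_form M x y = k * ((a*x+b*y)^4 + 6 * m * (a*x+b*y)\<^sup>2 * (c*x+d*y)\<^sup>2 + (c*x+d*y)^4)"
    using palindromic_equiv_dual_form[OF H pd] unfolding palindromic_equiv_def by metis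
  let ?R = "sym2 a b c d"
  define K where "K = (a * d - b * c)^4 * k"
  have K: "K > 0" using \<Delta> k by (simp add: K_def)
  have c: "?R ** M ** transpose ?R = canon_mat K m"
    unfolding K_def by (rule congruence_canon_mat[OF H \<Delta> e])
  \<comment> \<open>The middle diagonal entry \<open>K * m\<close> must be positive, which excludes
    the quartics with \<open>-1/3 < m \<le> 0\<close>.\<close>
  have "posdef (canon_mat K m)" using posdef_congruence[OF pd \<Delta>] unfolding c .
  moreover have "axis 2 1 \<noteq> (0 :: real^3)" by (simp add: axis_eq_0_iff)
  ultimately have "bil (canon_mat K m) (axis 2 1) (axis 2 1) > 0" by (simp add: posdef_def)
  then have m0: "m > 0" using K
    by (simp add: bil_def canon_mat_def inner_axis matrix_vector_mult_basis column_def inner_axis' zero_less_mult_iff)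
  have V: "Vol1 (matrix_inv M) = 2 * integral\<^sup>L lborel (canon_integrand m)"
    using Vol1_inv_congruence[OF hankel_symmetric[OF H] posdef_invertible[OF pd] \<Delta>]
      Vol1_inv_canon_mat[OF K m0] m unfolding c by simp
  have I3: "integral\<^sup>L lborel (canon_integrand (1/3)) = pi * sqrt (8/3)"
    using canon_integrand_third by (simp add: has_bochner_integral_iff)
  show "Vol1 (matrix_inv M) \<ge> 2 * (pi * sqrt (8/3))"
    unfolding V using canon_integral_gt[OF m0] I3 m by (metis less_eq_real_def mult_left_mono zero_le_numeral)
  assume "Vol1 (matrix_inv M) = 2 * (pi * sqrt (8/3))"
  then have "m = 1/3" unfolding V using canon_integral_gt[OF m0] m by fastforce
  then have "dual_form M x y = k * (sqnorm a b c d x y)\<^sup>2" for x y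
    unfolding e sqnorm_def by (simp, algebra)
  then show "\<exists>a b c d k. a * d - b * c \<noteq> 0 \<and> k > 0 \<and> (\<forall>x y. dual_form M x y = k * (sqnorm a b c d x y)\<^sup>2)"
    using \<Delta> k by blast
qed

section \<open>Designs in homogeneous coordinates\<close>

text \<open>Infinity is the point with homogeneous coordinates \<open>(1, 0)\<close>; every finite
  point has second coordinate 1.\<close>

fun hom_x :: "rproj \<Rightarrow> real" where "hom_x (Fin x) = x" | "hom_x Infty = 1"
fun hom_y :: "rproj \<Rightarrow> real" where "hom_y (Fin x) = 1" | "hom_y Infty = 0"

lemma hom_nonzero: "hom_x y \<noteq> 0 \<or> hom_y y \<noteq> 0"
  by (cases y) auto

lemma rproj_eq_iff: "y = z \<longleftrightarrow> hom_x y * hom_y z = hom_y y * hom_x z"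
  by (cases y; cases z) auto

lemma sqnorm_pos:
  assumes "a * d - b * c \<noteq> 0" "x \<noteq> 0 \<or> y \<noteq> 0"
  shows "sqnorm a b c d x y > 0"
proof -
  have "a * x + b * y \<noteq> 0 \<or> c * x + d * y \<noteq> 0"
  proof (rule ccontr)
    assume "\<not> ?thesis"
    then have "a * x + b * y = 0" "c * x + d * y = 0" by auto
    then have "(a * d - b * c) * x = 0" "(a * d - b * c) * y = 0" by algebra+
    then show False using assms by simp
  qed
  then show ?thesis unfolding sqnorm_def by (simp add: sum_power2_gt_zero_iff)
qed

lemma sqnorm_hom_pos: "a * d - b * c \<noteq> 0 \<Longrightarrow> sqnorm a b c d (hom_x y) (hom_y y) > 0"
  using sqnorm_pos hom_nonzero by blast

lemma sigmaP2_sqnorm: "sigmaP2 a b c d x = (sqnorm a b c d x 1)\<^sup>2"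
  unfolding sigmaP2_def sqnorm_def by algebra

lemma sqnorm_scale: "sqnorm a b c d (r * x) (r * y) = r\<^sup>2 * sqnorm a b c d x y"
  unfolding sqnorm_def by algebra

text \<open>For a function homogeneous of degree 0, the limit at infinity is continuity at
  \<open>(1, 0)\<close>. Information matrices and variance ratios are of this kind, being quotients
  of expressions of degree 4.\<close>

lemma value_at_homogeneous:
  fixes G :: "real \<Rightarrow> real \<Rightarrow> 'a::t2_space"
  assumes "\<And>x. x \<noteq> 0 \<Longrightarrow> G x 1 = G 1 (inverse x)" "isCont (G 1) 0"
  shows "value_at (\<lambda>x. G x 1) y = G (hom_x y) (hom_y y)"
proof (cases y)
  case Infty
  have "((\<lambda>x. G 1 (inverse x)) \<longlongrightarrow> G 1 0) at_infinity"
    using isCont_tendsto_compose[OF assms(2) tendsto_inverse_0] .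
  moreover have "\<forall>\<^sub>F x in at_infinity. G 1 (inverse x) = G x 1"
  proof -
    have "\<forall>\<^sub>F x::real in at_infinity. 1 \<le> norm x" unfolding eventually_at_infinity by blast
    then show ?thesis by eventually_elim (use assms(1) in force)
  qed
  ultimately have "((\<lambda>x. G x 1) \<longlongrightarrow> G 1 0) at_infinity" by (rule Lim_transform_eventually)
  then have "Lim at_infinity (\<lambda>x. G x 1) = G 1 0" by (intro tendsto_Lim trivial_limit_at_infinity)
  then show ?thesis using Infty by simp
qed simp

lemma sqnorm_inverse:
  assumes "x \<noteq> 0" shows "sqnorm a b c d x 1 = x\<^sup>2 * sqnorm a b c d 1 (inverse x)"
  using sqnorm_scale[of a b c d x 1 "inverse x"] assms by simp

definition veronese_outer :: "real \<Rightarrow> real \<Rightarrow> real^3^3" where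
  "veronese_outer x y = (\<chi> i j. veronese x y $ i * veronese x y $ j)"

lemma value_at_information:
  assumes "a * d - b * c \<noteq> 0"
  shows "value_at (\<lambda>x. \<chi> i j. fP x $ i * fP x $ j / sigmaP2 a b c d x) y
     = (1 / (sqnorm a b c d (hom_x y) (hom_y y))\<^sup>2) *\<^sub>R veronese_outer (hom_x y) (hom_y y)"
proof -
  define G where "G x y = (1 / (sqnorm a b c d x y)\<^sup>2) *\<^sub>R veronese_outer x y" for x y
  have "(\<lambda>x. \<chi> i j. fP x $ i * fP x $ j / sigmaP2 a b c d x) = (\<lambda>x. G x 1)"
    by (simp add: G_def veronese_outer_def fP_veronese sigmaP2_sqnorm vec_eq_iff fun_eq_iff)
  moreover have "value_at (\<lambda>x. G x 1) y = G (hom_x y) (hom_y y)"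
  proof (rule value_at_homogeneous)
    fix x :: real assume x: "x \<noteq> 0"
    have "veronese x 1 = x\<^sup>2 *\<^sub>R veronese 1 (inverse x)"
      using x by (simp add: veronese_def vec_eq_iff forall_3 power2_eq_square field_simps)
    then have "veronese_outer x 1 = (x\<^sup>2)\<^sup>2 *\<^sub>R veronese_outer 1 (inverse x)"
      by (simp add: veronese_outer_def vec_eq_iff power2_eq_square)
    then show "G x 1 = G 1 (inverse x)"
      unfolding G_def sqnorm_inverse[OF x] using x by (simp add: power_mult_distrib)
  next
    have nz: "sqnorm a b c d 1 y \<noteq> 0" for y using sqnorm_pos[OF assms, of 1 y] by simp
    have v: "isCont (\<lambda>y. veronese 1 y $ i) 0" for i
      using exhaust_3[of i] by (elim disjE) (simp_all add: veronese_def)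
    have "isCont (veronese_outer 1) 0"
      unfolding veronese_outer_def isCont_def
      by (rule vec_tendstoI)+ (simp, intro tendsto_mult v[unfolded isCont_def])
    moreover have "isCont (sqnorm a b c d 1) 0"
      unfolding sqnorm_def by (intro continuous_intros)
    ultimately show "isCont (G 1) 0"
      unfolding G_def using nz by (intro continuous_intros) auto
  qed
  ultimately show ?thesis by (simp add: G_def)
qed

lemma var_ratio_eq:
  assumes "a * d - b * c \<noteq> 0"
  shows "var_ratio a0 b0 c0 d0 a b c d y
    = (sqnorm a0 b0 c0 d0 (hom_x y) (hom_y y))\<^sup>2 / (sqnorm a b c d (hom_x y) (hom_y y))\<^sup>2"
proof -
  define G where "G x y = (sqnorm a0 b0 c0 d0 x y)\<^sup>2 / (sqnorm a b c d x y)\<^sup>2" for x y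
  have "value_at (\<lambda>x. G x 1) y = G (hom_x y) (hom_y y)"
  proof (rule value_at_homogeneous)
    fix x :: real assume x: "x \<noteq> 0"
    then show "G x 1 = G 1 (inverse x)"
      unfolding G_def sqnorm_inverse[OF x] by (simp add: power_mult_distrib)
  next
    have nz: "sqnorm a b c d 1 y \<noteq> 0" for y using sqnorm_pos[OF assms, of 1 y] by simp
    have "isCont (sqnorm p q r s 1) 0" for p q r s
      unfolding sqnorm_def by (intro continuous_intros)
    then show "isCont (G 1) 0"
      unfolding G_def using nz by (intro continuous_intros) auto
  qed
  then show ?thesis by (simp add: var_ratio_def sigmaP2_sqnorm G_def)
qed

lemma bil_veronese_outer: "bil (veronese_outer x y) u v = (u \<bullet> veronese x y) * (v \<bullet> veronese x y)"
  by (simp add: bil_def veronese_outer_def mat3_simps algebra_simps)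

lemma veronese_dual_inner_veronese: "veronese_dual x y \<bullet> veronese u v = (x * v - y * u)\<^sup>2"
  by (simp add: veronese_dual_def veronese_def mat3_simps power2_eq_square algebra_simps)

lemma hankel_veronese_outer: "hankel (veronese_outer x y)"
  by (simp add: hankel_def veronese_outer_def veronese_def power2_eq_square)

lemma hankel_sum: "(\<And>i. i \<in> S \<Longrightarrow> hankel (f i)) \<Longrightarrow> hankel (\<Sum>i\<in>S. r i *\<^sub>R f i)"
  by (simp add: hankel_def)

lemma bil_sum: "bil (\<Sum>i\<in>S. r i *\<^sub>R f i) u v = (\<Sum>i\<in>S. r i * bil (f i) u v)"
proof -
  have "(\<Sum>i\<in>S. r i *\<^sub>R f i) *v v = (\<Sum>i\<in>S. r i *\<^sub>R (f i *v v))"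
    by (induction S rule: infinite_finite_induct)
      (simp_all add: matrix_vector_mult_add_rdistrib scaleR_matrix_vector_assoc)
  then show ?thesis by (simp add: bil_def inner_sum_right)
qed

lemma info_matrix_eq:
  assumes "a * d - b * c \<noteq> 0"
  shows "info_matrix (sigmaP2 a b c d) w
    = (\<Sum>y\<in>supp w. (w y / (sqnorm a b c d (hom_x y) (hom_y y))\<^sup>2) *\<^sub>R veronese_outer (hom_x y) (hom_y y))"
  unfolding info_matrix_def value_at_information[OF assms] by simp

lemma hankel_info_matrix: "a * d - b * c \<noteq> 0 \<Longrightarrow> hankel (info_matrix (sigmaP2 a b c d) w)"
  unfolding info_matrix_eq by (intro hankel_sum hankel_veronese_outer)

lemma bil_info_matrix:
  assumes "a * d - b * c \<noteq> 0"
  shows "bil (info_matrix (sigmaP2 a b c d) w) u v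
    = (\<Sum>y\<in>supp w. w y / (sqnorm a b c d (hom_x y) (hom_y y))\<^sup>2 *
        ((u \<bullet> veronese (hom_x y) (hom_y y)) * (v \<bullet> veronese (hom_x y) (hom_y y))))"
  unfolding info_matrix_eq[OF assms] bil_sum bil_veronese_outer ..

lemma dual_form_info_matrix:
  assumes "a * d - b * c \<noteq> 0"
  shows "dual_form (info_matrix (sigmaP2 a b c d) w) x z
    = (\<Sum>y\<in>supp w. w y / (sqnorm a b c d (hom_x y) (hom_y y))\<^sup>2 * (x * hom_y y - z * hom_x y)^4)"
  unfolding dual_form_def bil_info_matrix[OF assms] veronese_dual_inner_veronese
  by (simp add: power2_eq_square power4_eq_xxxx mult.assoc)

lemma info_matrix_nonneg:
  assumes "a * d - b * c \<noteq> 0" "design w"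
  shows "bil (info_matrix (sigmaP2 a b c d) w) u u \<ge> 0"
  unfolding bil_info_matrix[OF assms(1)] using assms(2)
  by (intro sum_nonneg mult_nonneg_nonneg[OF _ zero_le_square] divide_nonneg_nonneg) (auto simp: design_def less_imp_le)

text \<open>The quadratic form is a sum of squares with positive factors. If it vanishes at
  \<open>u\<close>, then \<open>u\<close> is orthogonal to every vector of the design and lies in
  the kernel of the matrix.\<close>

lemma posdef_info_matrix:
  assumes \<Delta>: "a * d - b * c \<noteq> 0" and w: "design w" and inv: "invertible (info_matrix (sigmaP2 a b c d) w)"
  shows "posdef (info_matrix (sigmaP2 a b c d) w)"
  unfolding posdef_def
proof (intro allI impI)
  fix u :: "real^3" assume u: "u \<noteq> 0"
  let ?M = "info_matrix (sigmaP2 a b c d) w"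
  let ?t = "\<lambda>y. w y / (sqnorm a b c d (hom_x y) (hom_y y))\<^sup>2"
  let ?v = "\<lambda>y. veronese (hom_x y) (hom_y y)"
  have t: "?t y > 0" if "y \<in> supp w" for y
    using that w sqnorm_hom_pos[OF \<Delta>, of y] by (simp add: design_def)
  have fin: "finite (supp w)" using w by (simp add: design_def)
  have "bil ?M u u \<noteq> 0"
  proof
    assume "bil ?M u u = 0"
    then have "(\<Sum>y\<in>supp w. ?t y * (u \<bullet> ?v y)\<^sup>2) = 0"
      unfolding bil_info_matrix[OF \<Delta>] by (simp add: power2_eq_square)
    moreover have "?t y * (u \<bullet> ?v y)\<^sup>2 \<ge> 0" if "y \<in> supp w" for y
      by (intro mult_nonneg_nonneg less_imp_le[OF t[OF that]] zero_le_power2)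
    ultimately have "\<forall>y\<in>supp w. ?t y * (u \<bullet> ?v y)\<^sup>2 = 0"
      by (metis (no_types, lifting) fin sum_nonneg_eq_0_iff)
    then have "\<forall>y\<in>supp w. u \<bullet> ?v y = 0" using t by fastforce
    then have "bil ?M z u = 0" for z unfolding bil_info_matrix[OF \<Delta>] by simp
    then have "?M *v u = 0" unfolding bil_def by (metis inner_eq_zero_iff)
    then show False using inv u by (metis invertible_left_inverse matrix_left_invertible_ker)
  qed
  then show "bil ?M u u > 0" using info_matrix_nonneg[OF \<Delta> w, of u] by simp
qed

text \<open>In homogeneous coordinates a Moebius map is linear up to the factor \<open>r\<close>,
  which absorbs the special cases at infinity and at the pole.\<close>

lemma hom_mobius:
  assumes "a * d - b * c \<noteq> 0"
  obtains r where "r \<noteq> 0" "a * hom_x y + b * hom_y y = r * hom_x (mobius a b c d y)"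
    "c * hom_x y + d * hom_y y = r * hom_y (mobius a b c d y)"
proof (cases y)
  case (Fin x)
  show ?thesis
  proof (cases "c * x + d = 0")
    case True
    have "a * x + b \<noteq> 0"
    proof
      assume "a * x + b = 0"
      then have "a * d - b * c = 0" using True by algebra
      then show False using assms by simp
    qed
    then show ?thesis using that[of "a * x + b"] Fin True by simp
  next
    case False
    then show ?thesis using that[of "c * x + d"] Fin by simp
  qed
next
  case Infty
  then show ?thesis using that[of a] that[of c] assms by (cases "c = 0") auto
qed

lemma mobius_eq_iff:
  assumes "a * d - b * c \<noteq> 0"
  shows "mobius a b c d y = z \<longleftrightarrow>
    (a * hom_x y + b * hom_y y) * hom_y z = (c * hom_x y + d * hom_y y) * hom_x z"
proof -
  obtain r where "r \<noteq> 0" "a * hom_x y + b * hom_y y = r * hom_x (mobius a b c d y)"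
    "c * hom_x y + d * hom_y y = r * hom_y (mobius a b c d y)" using hom_mobius[OF assms] .
  then show ?thesis unfolding rproj_eq_iff by simp
qed

lemma mobius_mobius_inv:
  assumes "a * d - b * c \<noteq> 0"
  shows "mobius a b c d (mobius_inv a b c d y) = y"
  using mobius_inv_mobius[of d a "-b" "-c" y] assms by (simp add: mobius_inv_def algebra_simps)

section \<open>The stated family of designs\<close>

lemma tan_t0: "tan (pi * t0 1) = - sqrt 3" "tan (pi * t0 2) = 0" "tan (pi * t0 3) = sqrt 3"
proof -
  have 3: "pi * t0 3 = pi / 3" and 1: "pi * t0 1 = - (pi / 3)" by (simp_all add: t0_def)
  show "tan (pi * t0 3) = sqrt 3" unfolding 3 by (rule tan_60)
  then show "tan (pi * t0 1) = - sqrt 3" unfolding 1 3 by simp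
  show "tan (pi * t0 2) = 0" by (simp add: t0_def)
qed

lemma atLeast1_atMost3: "{1..3} = {1, 2, 3::nat}"
  by auto

lemma opt_point_inj:
  assumes "a * d - b * c \<noteq> 0"
  shows "inj_on (opt_point a b c d) {1..3}"
proof (rule inj_onI)
  fix i j :: nat assume ij: "i \<in> {1..3}" "j \<in> {1..3}" "opt_point a b c d i = opt_point a b c d j"
  then have "Fin (tan (pi * t0 i)) = Fin (tan (pi * t0 j))"
    unfolding opt_point_def using mobius_mobius_inv[OF assms] by metis
  then show "i = j" using ij(1,2)[unfolded atLeast1_atMost3] tan_t0 by auto
qed

text \<open>The three points are distinct, so \<open>weights_of\<close> never merges two weights and
  the design can be described by \<open>w\<close> alone.\<close>

lemma opt_design_iff:
  assumes \<Delta>0: "a0 * d0 - b0 * c0 \<noteq> 0" and \<Delta>: "a * d - b * c \<noteq> 0"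
  shows "opt_design a0 b0 c0 d0 a b c d w \<longleftrightarrow> supp w = opt_point a b c d ` {1..3} \<and>
    (\<Sum>i=1..3. w (opt_point a b c d i)) = 1 \<and>
    (\<exists>k>0. \<forall>i\<in>{1..3}. w (opt_point a b c d i) = k * var_ratio a0 b0 c0 d0 a b c d (opt_point a b c d i))"
    (is "?L \<longleftrightarrow> ?R")
proof
  note inj = opt_point_inj[OF \<Delta>]
  assume ?L
  then obtain k x p where k: "k > 0" and p: "(\<Sum>i=1..3. p i) = 1"
    and x: "\<And>i. i \<in> {1..3} \<Longrightarrow> x i = opt_point a b c d i"
    and pv: "\<And>i. i \<in> {1..3} \<Longrightarrow> p i = k * var_ratio a0 b0 c0 d0 a b c d (x i)"
    and w: "w = weights_of x p"
    unfolding opt_design_def by metis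
  have wi: "w (opt_point a b c d i) = p i" if i: "i \<in> {1..3}" for i
  proof -
    have "{j \<in> {1..3}. x j = opt_point a b c d i} = {i}"
      using i x by (auto simp: inj_on_eq_iff[OF inj])
    then show ?thesis by (simp add: w weights_of_def)
  qed
  have w0: "w y = 0" if "y \<notin> opt_point a b c d ` {1..3}" for y
  proof -
    have "{j \<in> {1..3}. x j = y} = {}" using that x by auto
    then show ?thesis unfolding w weights_of_def by (metis sum.empty)
  qed
  have ppos: "p i > 0" if "i \<in> {1..3}" for i
    using pv[OF that] k sqnorm_hom_pos[OF \<Delta>0, of "x i"] sqnorm_hom_pos[OF \<Delta>, of "x i"]
    by (simp add: var_ratio_eq[OF \<Delta>])
  have "supp w = opt_point a b c d ` {1..3}"
  proof (intro equalityI subsetI)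
    fix y assume "y \<in> supp w"
    then show "y \<in> opt_point a b c d ` {1..3}" using w0 by (auto simp: supp_def)
  next
    fix y assume "y \<in> opt_point a b c d ` {1..3}"
    then show "y \<in> supp w" using wi ppos by (fastforce simp: supp_def)
  qed
  moreover have "(\<Sum>i=1..3. w (opt_point a b c d i)) = 1" using p wi by simp
  moreover have "\<forall>i\<in>{1..3}. w (opt_point a b c d i) = k * var_ratio a0 b0 c0 d0 a b c d (opt_point a b c d i)"
    using wi pv x by simp
  ultimately show ?R using k by blast
next
  note inj = opt_point_inj[OF \<Delta>]
  assume R: ?R
  let ?x = "opt_point a b c d"
  have "w = weights_of ?x (\<lambda>i. w (?x i))"
  proof
    fix y
    show "w y = weights_of ?x (\<lambda>i. w (?x i)) y"
    proof (cases "y \<in> ?x ` {1..3}")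
      case True
      then obtain i where i: "i \<in> {1..3}" "y = ?x i" by blast
      then have "{j \<in> {1..3}. ?x j = y} = {i}" by (auto simp: inj_on_eq_iff[OF inj])
      then show ?thesis using i by (simp add: weights_of_def)
    next
      case False
      then have "{j \<in> {1..3}. ?x j = y} = {}" by auto
      moreover have "w y = 0" using False R by (auto simp: supp_def)
      ultimately show ?thesis unfolding weights_of_def by (metis sum.empty)
    qed
  qed
  then show ?L unfolding opt_design_def using R by blast
qed

lemma var_ratio_pos:
  assumes "a0 * d0 - b0 * c0 \<noteq> 0" "a * d - b * c \<noteq> 0"
  shows "var_ratio a0 b0 c0 d0 a b c d y > 0"
  using sqnorm_hom_pos[OF assms(1), of y] sqnorm_hom_pos[OF assms(2), of y] by (simp add: var_ratio_eq[OF assms(2)])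

lemma ex1_normalising_constant:
  assumes "a0 * d0 - b0 * c0 \<noteq> 0" "a * d - b * c \<noteq> 0"
  shows "\<exists>!k. k > 0 \<and> (\<Sum>i=1..3. k * var_ratio a0 b0 c0 d0 a b c d (opt_point a b c d i)) = 1"
proof -
  let ?S = "\<Sum>i=1..3. var_ratio a0 b0 c0 d0 a b c d (opt_point a b c d i)"
  have S: "?S > 0" by (rule sum_pos) (use var_ratio_pos[OF assms] in auto)
  have "(\<Sum>i=1..3. k * var_ratio a0 b0 c0 d0 a b c d (opt_point a b c d i)) = 1 \<longleftrightarrow> k = 1 / ?S" for k
    unfolding sum_distrib_left[symmetric] using S by (simp add: eq_divide_eq)
  then show ?thesis using S by auto
qed

lemma ex_opt_design:
  assumes "a0 * d0 - b0 * c0 \<noteq> 0" "a * d - b * c \<noteq> 0"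
  shows "\<exists>w. opt_design a0 b0 c0 d0 a b c d w"
proof -
  obtain k where "k > 0" "(\<Sum>i=1..3. k * var_ratio a0 b0 c0 d0 a b c d (opt_point a b c d i)) = 1"
    using ex1_normalising_constant[OF assms] by blast
  then show ?thesis unfolding opt_design_def
    by (intro exI[of _ "weights_of (opt_point a b c d) (\<lambda>i. k * var_ratio a0 b0 c0 d0 a b c d (opt_point a b c d i))"]
        exI[of _ k] exI[of _ "opt_point a b c d"]
        exI[of _ "\<lambda>i. k * var_ratio a0 b0 c0 d0 a b c d (opt_point a b c d i)"]) auto
qed

lemma opt_design_design:
  assumes \<Delta>0: "a0 * d0 - b0 * c0 \<noteq> 0" and \<Delta>: "a * d - b * c \<noteq> 0"
    and w: "opt_design a0 b0 c0 d0 a b c d w"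
  shows "design w" "three_point w"
proof -
  note w' = w[unfolded opt_design_iff[OF \<Delta>0 \<Delta>]]
  then have s: "supp w = opt_point a b c d ` {1..3}" by blast
  show "three_point w" unfolding three_point_def s card_image[OF opt_point_inj[OF \<Delta>]] by simp
  have "w y > 0" if "y \<in> supp w" for y
    using that w' var_ratio_pos[OF \<Delta>0 \<Delta>] by auto
  moreover have "sum w (supp w) = 1"
    unfolding s sum.reindex[OF opt_point_inj[OF \<Delta>]] using w' by simp
  ultimately show "design w" unfolding design_def s by simp
qed

text \<open>The variance ratio in the weights cancels the given variance and normalises each
  transformed linear form to a unit one. The three unit forms have directions 60 degrees apart
  modulo 180 degrees, and their fourth powers sum to \<open>9/8 * (u^2 + v^2)^2\<close>.\<close>

lemma opt_design_dual_form:
  assumes \<Delta>0: "a0 * d0 - b0 * c0 \<noteq> 0" and \<Delta>: "a * d - b * c \<noteq> 0"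
    and w: "opt_design a0 b0 c0 d0 a b c d w"
  shows "\<exists>K>0. \<forall>x z. dual_form (info_matrix (sigmaP2 a0 b0 c0 d0) w) x z = K * (sqnorm a b c d x z)\<^sup>2"
proof -
  let ?D = "a * d - b * c" and ?x = "opt_point a b c d"
  obtain k where k: "k > 0" and s: "supp w = ?x ` {1..3}"
    and wk: "\<And>i. i \<in> {1..3} \<Longrightarrow> w (?x i) = k * var_ratio a0 b0 c0 d0 a b c d (?x i)"
    using w unfolding opt_design_iff[OF \<Delta>0 \<Delta>] by blast
  have "?D^4 * dual_form (info_matrix (sigmaP2 a0 b0 c0 d0) w) x z = 9 / 8 * k * (sqnorm a b c d x z)\<^sup>2" for x z
  proof -
    define u v where "u = a * x + b * z" and "v = c * x + d * z"
    have summand: "?D^4 * (w (?x i) / (sqnorm a0 b0 c0 d0 (hom_x (?x i)) (hom_y (?x i)))\<^sup>2 * (x * hom_y (?x i) - z * hom_x (?x i))^4)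
       = k * (u - tan (pi * t0 i) * v)^4 / (1 + (tan (pi * t0 i))\<^sup>2)\<^sup>2" if i: "i \<in> {1..3}" for i
    proof -
      define T X Y where "T = tan (pi * t0 i)" and "X = hom_x (?x i)" and "Y = hom_y (?x i)"
      have "mobius a b c d (?x i) = Fin T" unfolding opt_point_def T_def by (rule mobius_mobius_inv[OF \<Delta>])
      then obtain r where r: "r \<noteq> 0" "a * X + b * Y = r * T" "c * X + d * Y = r"
        using hom_mobius[OF \<Delta>, of "?x i"] unfolding X_def Y_def by auto
      have sq: "sqnorm a b c d X Y = r\<^sup>2 * (1 + T\<^sup>2)"
        unfolding sqnorm_def r by (simp add: power_mult_distrib algebra_simps)
      have n0: "sqnorm a0 b0 c0 d0 X Y \<noteq> 0" using sqnorm_hom_pos[OF \<Delta>0, of "?x i"] by (simp add: X_def Y_def)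
      have T: "1 + T\<^sup>2 \<noteq> 0" by (smt (verit) zero_le_power2)
      have "w (?x i) / (sqnorm a0 b0 c0 d0 X Y)\<^sup>2 = k / (r\<^sup>2 * (1 + T\<^sup>2))\<^sup>2"
        unfolding wk[OF i] var_ratio_eq[OF \<Delta>] X_def[symmetric] Y_def[symmetric] sq using n0 by simp
      moreover have "?D * (x * Y - z * X) = r * (u - T * v)"
        using r unfolding u_def v_def by algebra
      then have "?D^4 * (x * Y - z * X)^4 = r^4 * (u - T * v)^4" by (metis power_mult_distrib)
      then have "?D^4 * (K * (x * Y - z * X)^4) = K * (r^4 * (u - T * v)^4)" for K by (simp add: mult_ac)
      ultimately have "?D^4 * (w (?x i) / (sqnorm a0 b0 c0 d0 X Y)\<^sup>2 * (x * Y - z * X)^4)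
          = k / (r\<^sup>2 * (1 + T\<^sup>2))\<^sup>2 * (r^4 * (u - T * v)^4)" by simp
      also have "\<dots> = k * (u - T * v)^4 / (1 + T\<^sup>2)\<^sup>2"
        using r(1) T by (simp add: power_mult_distrib)
      finally show ?thesis by (simp add: T_def X_def Y_def)
    qed
    have "?D^4 * dual_form (info_matrix (sigmaP2 a0 b0 c0 d0) w) x z
      = (\<Sum>i=1..3. k * (u - tan (pi * t0 i) * v)^4 / (1 + (tan (pi * t0 i))\<^sup>2)\<^sup>2)"
      unfolding dual_form_info_matrix[OF \<Delta>0] s sum.reindex[OF opt_point_inj[OF \<Delta>]] sum_distrib_left
      using summand by (intro sum.cong) auto
    also have "\<dots> = k * ((u + sqrt 3 * v)^4 / 16 + u^4 + (u - sqrt 3 * v)^4 / 16)"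
      unfolding atLeast1_atMost3 by (simp add: tan_t0[simplified] algebra_simps)
    also have "(u + sqrt 3 * v)^4 / 16 + u^4 + (u - sqrt 3 * v)^4 / 16 = 9 / 8 * (u\<^sup>2 + v\<^sup>2)\<^sup>2"
    proof -
      define q where "q = sqrt 3"
      have q: "q * q = 3" by (simp add: q_def)
      have "(u + q * v)^4 + 16 * u^4 + (u - q * v)^4 = 18 * u^4 + 12 * (q * q) * u\<^sup>2 * v\<^sup>2 + 2 * (q * q)\<^sup>2 * v^4"
        by algebra
      also have "\<dots> = 18 * (u\<^sup>2 + v\<^sup>2)\<^sup>2" unfolding q by algebra
      finally have "(u + q * v)^4 + 16 * u^4 + (u - q * v)^4 = 18 * (u\<^sup>2 + v\<^sup>2)\<^sup>2" .
      then show ?thesis unfolding q_def by simp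
    qed
    finally show ?thesis by (simp add: sqnorm_def u_def v_def)
  qed
  then have "dual_form (info_matrix (sigmaP2 a0 b0 c0 d0) w) x z = (9 / 8 * k / ?D^4) * (sqnorm a b c d x z)\<^sup>2" for x z
    using \<Delta> by (metis (no_types, lifting) nonzero_eq_divide_eq mult.commute times_divide_eq_left power_not_zero)
  moreover have "9 / 8 * k / ?D^4 > 0" using k \<Delta> by simp
  ultimately show ?thesis by blast
qed

section \<open>Three-point designs\<close>

text \<open>Comparing coefficients gives \<open>u = w\<close> and then \<open>v = u\<close> or
  \<open>v = 2 * u\<close>. In the second case the right side would be a multiple of
  \<open>(x + y)^4\<close>, forcing \<open>t1 = 0\<close>.\<close>

lemma three_fourth_powers_square:
  fixes t1 t2 t3 \<kappa> u v w :: real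
  assumes pos: "t1 > 0" "t2 > 0" "t3 > 0" "\<kappa> > 0"
    and e: "\<And>x y. t1 * x^4 + t2 * y^4 + t3 * (x + y)^4 = \<kappa> * (u * x\<^sup>2 + v * x * y + w * y\<^sup>2)\<^sup>2"
  shows "t1 = t3" "t2 = t3"
proof -
  have 1: "t1 + t3 = \<kappa> * u\<^sup>2" and 2: "t2 + t3 = \<kappa> * w\<^sup>2" using e[of 1 0] e[of 0 1] by simp_all
  have 3: "t1 + t2 + 16 * t3 = \<kappa> * (u + v + w)\<^sup>2" "t1 + t2 = \<kappa> * (u - v + w)\<^sup>2"
    "t1 + 16 * t2 + 81 * t3 = \<kappa> * (u + 2 * v + 4 * w)\<^sup>2"
    using e[of 1 1] e[of 1 "-1"] e[of 1 2] by (simp_all add: algebra_simps)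
  have 4: "4 * t3 = 2 * (\<kappa> * (u * v))" "6 * t3 = \<kappa> * (v\<^sup>2 + 2 * u * w)" "4 * t3 = 2 * (\<kappa> * (v * w))"
    using 1 2 3 by (simp_all add: power2_eq_square algebra_simps)
  have v: "v \<noteq> 0" using 4(1) pos by auto
  have "u * v = v * w" using 4(1,3) pos by auto
  then have uw: "w = u" using v by simp
  have "\<kappa> * ((v - u) * (v - 2 * u)) = 0" using 4(1,2) unfolding uw by (simp add: power2_eq_square algebra_simps)
  then have "v = u \<or> v = 2 * u" using pos by simp
  moreover have "v \<noteq> 2 * u"
  proof
    assume "v = 2 * u"
    then have "t3 = \<kappa> * u\<^sup>2" using 4(1) by (simp add: power2_eq_square)
    then show False using 1 pos by simp
  qed
  ultimately have "v = u" by simp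
  then have "2 * t3 = \<kappa> * u\<^sup>2" using 4(1) by (simp add: power2_eq_square)
  then show "t1 = t3" "t2 = t3" using 1 2 uw by simp_all
qed

lemma opt_point_eqI:
  assumes "a * d - b * c \<noteq> 0"
    and "a * hom_x y + b * hom_y y = (c * hom_x y + d * hom_y y) * tan (pi * t0 i)"
  shows "opt_point a b c d i = y"
proof -
  have "mobius a b c d y = Fin (tan (pi * t0 i))"
    unfolding mobius_eq_iff[OF assms(1)] using assms(2) by simp
  then show ?thesis unfolding opt_point_def using mobius_inv_mobius[OF assms(1)] by metis
qed

text \<open>The multiples \<open>(h\<^sub>i, g\<^sub>i)\<close> of the homogeneous coordinates of the three points have sum zero, and
  the required linear map sends them to \<open>\<delta> (-\<surd>3, 1)\<close>, \<open>\<delta> (0, -2)\<close> and \<open>\<delta> (\<surd>3, 1)\<close>. The sign of its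
  determinant depends on the order of the points.\<close>

lemma three_points_opt_design:
  assumes \<Delta>0: "a0 * d0 - b0 * c0 \<noteq> 0" and w: "design w"
    and s: "supp w = {y1, y2, y3}" and ne: "y1 \<noteq> y2" "y2 \<noteq> y3" "y1 \<noteq> y3"
    and \<kappa>: "\<kappa> > 0"
    and e: "\<And>x z. dual_form (info_matrix (sigmaP2 a0 b0 c0 d0) w) x z = \<kappa> * (sqnorm p q r t x z)\<^sup>2"
  defines "br \<equiv> \<lambda>y z. hom_x y * hom_y z - hom_y y * hom_x z"
  shows "\<exists>a b c d. (a * d - b * c) * (br y2 y3 * br y3 y1 * br y1 y2) > 0 \<and> opt_design a0 b0 c0 d0 a b c d w"
proof -
  \<comment> \<open>By Cramer's rule these brackets are the coefficients of a linear relation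
    between the three coordinate vectors in the plane.\<close>
  define r1 r2 r3 where "r1 = br y2 y3" and "r2 = br y3 y1" and "r3 = br y1 y2"
  have nz: "r1 \<noteq> 0" "r2 \<noteq> 0" "r3 \<noteq> 0"
    using ne ne(3)[symmetric] unfolding r1_def r2_def r3_def br_def by (auto simp: rproj_eq_iff)
  define h1 g1 h2 g2 h3 g3 where "h1 = r1 * hom_x y1" and "g1 = r1 * hom_y y1"
    and "h2 = r2 * hom_x y2" and "g2 = r2 * hom_y y2"
    and "h3 = r3 * hom_x y3" and "g3 = r3 * hom_y y3"
  have sum0: "h1 + h2 + h3 = 0" "g1 + g2 + g3 = 0"
    unfolding h1_def h2_def h3_def g1_def g2_def g3_def r1_def r2_def r3_def br_def by algebra+
  define \<delta> where "\<delta> = h1 * g2 - g1 * h2"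
  have \<delta>: "\<delta> = r1 * r2 * r3" unfolding \<delta>_def h1_def h2_def g1_def g2_def r3_def br_def by algebra
  have \<delta>0: "\<delta> \<noteq> 0" using nz by (simp add: \<delta>)
  define N where "N y = sqnorm a0 b0 c0 d0 (hom_x y) (hom_y y)" for y
  have N: "N y > 0" for y using sqnorm_hom_pos[OF \<Delta>0] by (simp add: N_def)
  have wpos: "w y1 > 0" "w y2 > 0" "w y3 > 0" using w s by (auto simp: design_def)
  \<comment> \<open>These are the coefficients of the fourth powers once the linear forms have been
    rescaled by \<open>r1\<close>, \<open>r2\<close>, \<open>r3\<close>.\<close>
  define t1 t2 t3 where "t1 = w y1 / (N y1)\<^sup>2 / r1^4" and "t2 = w y2 / (N y2)\<^sup>2 / r2^4" and "t3 = w y3 / (N y3)\<^sup>2 / r3^4"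
  have tpos: "t1 > 0" "t2 > 0" "t3 > 0"
    unfolding t1_def t2_def t3_def using wpos N nz
    by (auto intro!: divide_pos_pos mult_pos_pos simp: zero_less_power_eq less_imp_neq[THEN not_sym])
  have wt: "w y1 / (N y1)\<^sup>2 = t1 * r1^4" "w y2 / (N y2)\<^sup>2 = t2 * r2^4" "w y3 / (N y3)\<^sup>2 = t3 * r3^4"
    unfolding t1_def t2_def t3_def using nz by simp_all
  have dual: "t1 * (x * g1 - z * h1)^4 + t2 * (x * g2 - z * h2)^4 + t3 * (x * g3 - z * h3)^4
     = \<kappa> * (sqnorm p q r t x z)\<^sup>2" for x z
  proof -
    have m: "t * R^4 * (x * Y - z * X)^4 = t * (x * (R * Y) - z * (R * X))^4" for t R X Y
      by (simp add: power_mult_distrib[symmetric] algebra_simps)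
    have "\<kappa> * (sqnorm p q r t x z)\<^sup>2 = (\<Sum>y\<in>{y1,y2,y3}. w y / (N y)\<^sup>2 * (x * hom_y y - z * hom_x y)^4)"
      unfolding e[symmetric] dual_form_info_matrix[OF \<Delta>0] s N_def ..
    also have "\<dots> = t1 * r1^4 * (x * hom_y y1 - z * hom_x y1)^4 + t2 * r2^4 * (x * hom_y y2 - z * hom_x y2)^4
        + t3 * r3^4 * (x * hom_y y3 - z * hom_x y3)^4"
      using ne by (simp del: times_divide_eq_left add: wt)
    finally show ?thesis unfolding m h1_def h2_def h3_def g1_def g2_def g3_def by simp
  qed
  define \<alpha> \<beta> \<gamma> where "\<alpha> = p\<^sup>2 + r\<^sup>2" and "\<beta> = 2 * (p * q + r * t)" and "\<gamma> = q\<^sup>2 + t\<^sup>2"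
  have sq: "sqnorm p q r t x z = \<alpha> * x\<^sup>2 + \<beta> * x * z + \<gamma> * z\<^sup>2" for x z
    unfolding sqnorm_def \<alpha>_def \<beta>_def \<gamma>_def by algebra
  have "t1 = t3 \<and> t2 = t3"
  proof -
    define \<epsilon> where "\<epsilon> = 1 / \<delta>"
    have ed: "\<epsilon> * (h1 * g2 - g1 * h2) = 1" using \<delta>0 by (simp add: \<epsilon>_def \<delta>_def)
    \<comment> \<open>The first two rescaled forms become the coordinates \<xi> and \<eta>, and the
      third is minus their sum. The new \<open>u\<close>, \<open>v\<close>, \<open>w\<close> are the
      coefficients of the quadratic form in these coordinates.\<close>
    define u v w where "u = \<alpha> * (\<epsilon> * h2)\<^sup>2 + \<beta> * (\<epsilon> * h2) * (\<epsilon> * g2) + \<gamma> * (\<epsilon> * g2)\<^sup>2"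
      and "v = - (2 * \<alpha> * (\<epsilon> * h1) * (\<epsilon> * h2) + \<beta> * ((\<epsilon> * h1) * (\<epsilon> * g2) + (\<epsilon> * h2) * (\<epsilon> * g1)) + 2 * \<gamma> * (\<epsilon> * g1) * (\<epsilon> * g2))"
      and "w = \<alpha> * (\<epsilon> * h1)\<^sup>2 + \<beta> * (\<epsilon> * h1) * (\<epsilon> * g1) + \<gamma> * (\<epsilon> * g1)\<^sup>2"
    have key: "t1 * \<xi>^4 + t2 * \<eta>^4 + t3 * (\<xi> + \<eta>)^4 = \<kappa> * (u * \<xi>\<^sup>2 + v * \<xi> * \<eta> + w * \<eta>\<^sup>2)\<^sup>2" for \<xi> \<eta>
    proof -
      define x z where "x = \<epsilon> * h1 * \<eta> - \<epsilon> * h2 * \<xi>" and "z = \<epsilon> * g1 * \<eta> - \<epsilon> * g2 * \<xi>"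
      have x1: "x * g1 - z * h1 = \<xi>" unfolding x_def z_def using ed by algebra
      have x2: "x * g2 - z * h2 = \<eta>" unfolding x_def z_def using ed by algebra
      have x3: "x * g3 - z * h3 = - (\<xi> + \<eta>)"
      proof -
        have hg: "h3 = - h1 - h2" "g3 = - g1 - g2" using sum0 by linarith+
        show ?thesis unfolding hg x1[symmetric] x2[symmetric] by (simp add: algebra_simps)
      qed
      have "\<alpha> * x\<^sup>2 + \<beta> * x * z + \<gamma> * z\<^sup>2 = u * \<xi>\<^sup>2 + v * \<xi> * \<eta> + w * \<eta>\<^sup>2"
        unfolding x_def z_def u_def v_def w_def by algebra
      moreover have "(- (\<xi> + \<eta>))^4 = (\<xi> + \<eta>)^4" by (rule power_minus_even) simp
      ultimately show ?thesis using dual[of x z] unfolding sq x1 x2 x3 by (simp only:)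
    qed
    show ?thesis using three_fourth_powers_square[OF tpos \<kappa> key] by simp
  qed
  then have teq: "t1 = t3" "t2 = t3" by auto
  define q3 where "q3 = sqrt 3"
  have q3: "q3 * q3 = 3" "q3 > 0" by (simp_all add: q3_def)
  define a b c d where "a = - q3 * g2" and "b = q3 * h2" and "c = g2 + 2 * g1" and "d = - h2 - 2 * h1"
  have det: "a * d - b * c = 2 * q3 * \<delta>" unfolding a_def b_def c_def d_def \<delta>_def by algebra
  have \<Delta>: "a * d - b * c \<noteq> 0" unfolding det using \<delta>0 q3 by simp
  have im: "a * h1 + b * g1 = - q3 * \<delta>" "c * h1 + d * g1 = \<delta>"
    "a * h2 + b * g2 = 0" "c * h2 + d * g2 = - 2 * \<delta>"
    "a * h3 + b * g3 = q3 * \<delta>" "c * h3 + d * g3 = \<delta>"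
    unfolding a_def b_def c_def d_def \<delta>_def using sum0 by algebra+
  have im1: "r1 * (a * hom_x y1 + b * hom_y y1) = - q3 * \<delta>" "r1 * (c * hom_x y1 + d * hom_y y1) = \<delta>"
    and im2: "r2 * (a * hom_x y2 + b * hom_y y2) = 0" "r2 * (c * hom_x y2 + d * hom_y y2) = - 2 * \<delta>"
    and im3: "r3 * (a * hom_x y3 + b * hom_y y3) = q3 * \<delta>" "r3 * (c * hom_x y3 + d * hom_y y3) = \<delta>"
    using im unfolding h1_def g1_def h2_def g2_def h3_def g3_def by (simp_all add: algebra_simps)
  have "r1 * (a * hom_x y1 + b * hom_y y1) = r1 * ((c * hom_x y1 + d * hom_y y1) * - q3)"
    using im1 by algebra
  then have o1: "opt_point a b c d 1 = y1"
    using nz by (intro opt_point_eqI[OF \<Delta>]) (simp only: tan_t0 q3_def[symmetric] mult_cancel_left, blast)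
  have o2: "opt_point a b c d 2 = y2"
    using im2(1) nz by (intro opt_point_eqI[OF \<Delta>]) (simp add: tan_t0)
  have "r3 * (a * hom_x y3 + b * hom_y y3) = r3 * ((c * hom_x y3 + d * hom_y y3) * q3)"
    using im3 by algebra
  then have o3: "opt_point a b c d 3 = y3"
    using nz by (intro opt_point_eqI[OF \<Delta>]) (simp only: tan_t0 q3_def[symmetric] mult_cancel_left, blast)
  \<comment> \<open>The three image vectors all have squared length
    \<open>4 *\<close>\<delta>\<open>^2\<close>. With equal \<open>t1\<close>, \<open>t2\<close>,
    \<open>t3\<close> this makes the weights proportional to the variance ratios.\<close>
  have sqn: "sqnorm a b c d (hom_x y) (hom_y y) = 4 * \<delta>\<^sup>2 / R\<^sup>2"
    if "(R * (a * hom_x y + b * hom_y y))\<^sup>2 + (R * (c * hom_x y + d * hom_y y))\<^sup>2 = 4 * \<delta>\<^sup>2" "R \<noteq> 0" for y R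
  proof -
    have "R\<^sup>2 * sqnorm a b c d (hom_x y) (hom_y y) = 4 * \<delta>\<^sup>2"
      unfolding that(1)[symmetric] sqnorm_def by algebra
    then show ?thesis using that(2) by (simp add: eq_divide_eq mult.commute)
  qed
  have sq1: "sqnorm a b c d (hom_x y1) (hom_y y1) = 4 * \<delta>\<^sup>2 / r1\<^sup>2"
    by (rule sqn[OF _ nz(1)]) (use im1 q3 in \<open>simp add: power_mult_distrib power2_eq_square\<close>)
  have sq2: "sqnorm a b c d (hom_x y2) (hom_y y2) = 4 * \<delta>\<^sup>2 / r2\<^sup>2"
    by (rule sqn[OF _ nz(2)]) (use im2 in \<open>simp add: power_mult_distrib\<close>)
  have sq3: "sqnorm a b c d (hom_x y3) (hom_y y3) = 4 * \<delta>\<^sup>2 / r3\<^sup>2"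
    by (rule sqn[OF _ nz(3)]) (use im3 q3 in \<open>simp add: power_mult_distrib power2_eq_square\<close>)
  define k where "k = 16 * \<delta>^4 * t3"
  have k: "k > 0" using tpos \<delta>0 by (simp add: k_def)
  have wv: "w y = k * var_ratio a0 b0 c0 d0 a b c d y"
    if "w y / (N y)\<^sup>2 = t3 * R^4" "sqnorm a b c d (hom_x y) (hom_y y) = 4 * \<delta>\<^sup>2 / R\<^sup>2" "R \<noteq> 0" for y R
  proof -
    have "w y = t3 * R^4 * (N y)\<^sup>2" using that(1) N[of y] by (simp add: divide_eq_eq)
    moreover have "var_ratio a0 b0 c0 d0 a b c d y = (N y)\<^sup>2 / (4 * \<delta>\<^sup>2 / R\<^sup>2)\<^sup>2"
      unfolding var_ratio_eq[OF \<Delta>] that(2) N_def ..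
    ultimately show ?thesis using that(3) \<delta>0
      by (simp add: k_def power_divide power_mult_distrib)
  qed
  have "opt_design a0 b0 c0 d0 a b c d w"
    unfolding opt_design_iff[OF \<Delta>0 \<Delta>]
  proof (intro conjI exI[of _ k] k ballI)
    show "supp w = opt_point a b c d ` {1..3}"
      unfolding atLeast1_atMost3 s by (simp only: image_insert image_empty o1 o2 o3)
    have "(\<Sum>i=1..3. w (opt_point a b c d i)) = w y1 + (w y2 + w y3)"
      unfolding atLeast1_atMost3 by (simp add: o1[simplified] o2 o3)
    also have "\<dots> = 1" using w ne unfolding design_def s by simp
    finally show "(\<Sum>i=1..3. w (opt_point a b c d i)) = 1" .
    fix i :: nat assume "i \<in> {1..3}"
    then have "i = 1 \<or> i = 2 \<or> i = 3" by auto
    then show "w (opt_point a b c d i) = k * var_ratio a0 b0 c0 d0 a b c d (opt_point a b c d i)"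
      using wv[OF _ sq1 nz(1)] wv[OF _ sq2 nz(2)] wv[OF _ sq3 nz(3)] wt teq o1 o2 o3 by metis
  qed
  moreover have "(a * d - b * c) * (br y2 y3 * br y3 y1 * br y1 y2) > 0"
  proof -
    have "(a * d - b * c) * (br y2 y3 * br y3 y1 * br y1 y2) = 2 * q3 * \<delta>\<^sup>2"
      unfolding det \<delta> r1_def r2_def r3_def by (simp add: power2_eq_square mult_ac)
    then show ?thesis using q3 \<delta>0 by simp
  qed
  ultimately show ?thesis by blast
qed

text \<open>Exchanging the first and third points reverses the sign of the determinant, so the sign
  can be prescribed through \<open>n\<close>.\<close>

lemma three_point_opt_design:
  assumes \<Delta>0: "a0 * d0 - b0 * c0 \<noteq> 0" and w: "design w" "three_point w" and \<kappa>: "\<kappa> > 0"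
    and e: "\<And>x z. dual_form (info_matrix (sigmaP2 a0 b0 c0 d0) w) x z = \<kappa> * (sqnorm p q r t x z)\<^sup>2"
    and n: "n \<noteq> 0"
  shows "\<exists>a b c d. (a * d - b * c) * n > 0 \<and> opt_design a0 b0 c0 d0 a b c d w"
proof -
  obtain y1 y2 y3 where s: "supp w = {y1, y2, y3}" and ne: "y1 \<noteq> y2" "y2 \<noteq> y3" "y1 \<noteq> y3"
    using w(2) unfolding three_point_def card_3_iff by blast
  define br where "br y z = hom_x y * hom_y z - hom_y y * hom_x z" for y z
  let ?\<delta> = "br y2 y3 * br y3 y1 * br y1 y2" and ?\<delta>' = "br y2 y1 * br y1 y3 * br y3 y2"
  have s': "supp w = {y3, y2, y1}" using s by auto
  have "?\<delta>' = - ?\<delta>" unfolding br_def by algebra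
  moreover have "?\<delta> \<noteq> 0" using ne ne(3)[symmetric] unfolding br_def by (auto simp: rproj_eq_iff)
  ultimately have "?\<delta>' * n = - (?\<delta> * n)" "?\<delta> * n \<noteq> 0" using n by (simp_all del: mult_eq_0_iff add: no_zero_divisors)
  then have pick: "?\<delta> * n > 0 \<or> ?\<delta>' * n > 0" by linarith
  have same_sign: "D * n > 0" if "D * x > 0" "x * n > 0" for D x :: real
    using that by (auto simp: zero_less_mult_iff)
  from pick show ?thesis
  proof
    assume "?\<delta> * n > 0"
    then show ?thesis
      using three_points_opt_design[OF \<Delta>0 w(1) s ne \<kappa> e, folded br_def] same_sign by blast
  next
    assume "?\<delta>' * n > 0"
    then show ?thesis
      using three_points_opt_design[OF \<Delta>0 w(1) s' ne(2)[symmetric] ne(1)[symmetric] ne(3)[symmetric] \<kappa> e, folded br_def]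
        same_sign by blast
  qed
qed

section \<open>Tube-volume optimality\<close>

lemma tube_volume_optimal_three_point:
  assumes \<Delta>0: "a0 * d0 - b0 * c0 \<noteq> 0"
  shows "{w. three_point w \<and> tube_volume_optimal (sigmaP2 a0 b0 c0 d0) w}
     = {w. \<exists>a b c d. a * d - b * c \<noteq> 0 \<and> opt_design a0 b0 c0 d0 a b c d w}"
proof -
  let ?M = "info_matrix (sigmaP2 a0 b0 c0 d0)" and ?V = "2 * (pi * sqrt (8/3))"
  note H = hankel_info_matrix[OF \<Delta>0]
  have bound: "?V \<le> Vol1 (matrix_inv (?M v))" if "design v" "invertible (?M v)" for v
    by (rule Vol1_inv_bound(1)[OF H posdef_info_matrix[OF \<Delta>0 that]])
  have attain: "invertible (?M w) \<and> Vol1 (matrix_inv (?M w)) = ?V"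
    if \<Delta>: "a * d - b * c \<noteq> 0" and w: "opt_design a0 b0 c0 d0 a b c d w" for a b c d w
  proof -
    obtain K where "K > 0" "\<And>x z. dual_form (?M w) x z = K * (sqnorm a b c d x z)\<^sup>2"
      using opt_design_dual_form[OF \<Delta>0 \<Delta> w] by blast
    then show ?thesis using square_dual_form(2,3)[OF H \<Delta>] by blast
  qed
  have "\<exists>a b c d. a * d - b * c \<noteq> 0 \<and> opt_design a0 b0 c0 d0 a b c d w"
    if w3: "three_point w" and w: "tube_volume_optimal (sigmaP2 a0 b0 c0 d0) w" for w
  proof -
    \<comment> \<open>A member of the family attains the lower bound, so every optimal design must
      attain it too.\<close>
    obtain v where v: "opt_design a0 b0 c0 d0 a0 b0 c0 d0 v" using ex_opt_design[OF \<Delta>0 \<Delta>0] by blast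
    have wd: "design w" and wi: "invertible (?M w)" using w by (auto simp: tube_volume_optimal_def)
    have "Vol1 (matrix_inv (?M w)) \<le> Vol1 (matrix_inv (?M v))"
      using w opt_design_design(1)[OF \<Delta>0 \<Delta>0 v] attain[OF \<Delta>0 v] by (auto simp: tube_volume_optimal_def)
    then have "Vol1 (matrix_inv (?M w)) = ?V" using attain[OF \<Delta>0 v] bound[OF wd wi] by simp
    then obtain p q r t k where "k > 0" "\<And>x z. dual_form (?M w) x z = k * (sqnorm p q r t x z)\<^sup>2"
      using Vol1_inv_bound(2)[OF H posdef_info_matrix[OF \<Delta>0 wd wi]] by blast
    then obtain a b c d where "(a * d - b * c) * 1 > 0" "opt_design a0 b0 c0 d0 a b c d w"
      using three_point_opt_design[OF \<Delta>0 wd w3, of k p q r t 1] by auto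
    then show ?thesis by (metis less_irrefl mult_zero_left)
  qed
  moreover have "three_point w \<and> tube_volume_optimal (sigmaP2 a0 b0 c0 d0) w"
    if "a * d - b * c \<noteq> 0" "opt_design a0 b0 c0 d0 a b c d w" for a b c d w
    using opt_design_design[OF \<Delta>0 that] attain[OF that] bound by (simp add: tube_volume_optimal_def)
  ultimately show ?thesis by blast
qed

section \<open>D-optimality\<close>

text \<open>\<open>1, A, B, E, G, 1 - E\<close> are the moments of the transformed design in the basis
  \<open>1, cos 2\<theta>, sin 2\<theta>\<close> of the trigonometric regression.\<close>

lemma det_information_bound:
  assumes \<Delta>0: "a0 * d0 - b0 * c0 \<noteq> 0" and w: "design w"
  defines "M \<equiv> info_matrix (sigmaP2 a0 b0 c0 d0) w"
  shows "(a0 * d0 - b0 * c0)^6 * det M \<le> 1/64"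
    and "(a0 * d0 - b0 * c0)^6 * det M = 1/64 \<longleftrightarrow>
      (\<exists>\<kappa>>0. \<forall>x z. dual_form M x z = \<kappa> * (sqnorm a0 b0 c0 d0 x z)\<^sup>2)"
proof -
  let ?R = "sym2 a0 b0 c0 d0"
  define N where "N = ?R ** M ** transpose ?R"
  have HM: "hankel M" unfolding M_def by (rule hankel_info_matrix[OF \<Delta>0])
  have H: "hankel N" unfolding N_def by (rule hankel_congruence[OF HM])
  define n0 n1 n2 n3 n4 where "n0 = N$1$1" and "n1 = N$1$2" and "n2 = N$2$2" and "n3 = N$2$3" and "n4 = N$3$3"
  have entries: "N$1$1 = n0" "N$1$2 = n1" "N$1$3 = n2" "N$2$1 = n1" "N$2$2 = n2" "N$2$3 = n3"
    "N$3$1 = n2" "N$3$2 = n3" "N$3$3 = n4"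
    using H by (simp_all add: hankel_def n0_def n1_def n2_def n3_def n4_def)
  have det: "det N = (a0 * d0 - b0 * c0)^6 * det M"
  proof -
    have "x^3 * D * x^3 = x^6 * D" for x D :: real by algebra
    then show ?thesis by (simp add: N_def det_mul det_sym2)
  qed
  have bilN: "bil N u u = u$1 * u$1 * n0 + 2 * u$1 * u$2 * n1 + (2 * u$1 * u$3 + u$2 * u$2) * n2
      + 2 * u$2 * u$3 * n3 + u$3 * u$3 * n4" for u
    unfolding bil_def by (simp add: mat3_simps entries algebra_simps)
  have nonneg: "bil N u u \<ge> 0" for u
    unfolding N_def bil_congruence' M_def by (rule info_matrix_nonneg[OF \<Delta>0 w])
  \<comment> \<open>For the transformed design the variance is \<open>(x^2 + y^2)^2\<close>, the sum
    of \<open>y^4\<close>, \<open>2 * x^2 * y^2\<close> and \<open>x^4\<close>; total weight 1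
    therefore becomes this linear relation.\<close>
  have trace: "n0 + 2 * n2 + n4 = 1"
  proof -
    let ?S = "\<lambda>y. sqnorm a0 b0 c0 d0 (hom_x y) (hom_y y)"
    let ?v = "\<lambda>y. veronese (a0 * hom_x y + b0 * hom_y y) (c0 * hom_x y + d0 * hom_y y)"
    have b: "bil N u u = (\<Sum>y\<in>supp w. w y / (?S y)\<^sup>2 * (u \<bullet> ?v y)\<^sup>2)" for u
    proof -
      have "(transpose ?R *v u) \<bullet> veronese x y = u \<bullet> veronese (a0 * x + b0 * y) (c0 * x + d0 * y)" for x y
        unfolding sym2_veronese[symmetric] by (metis dot_lmul_matrix transpose_matrix_vector)
      then show ?thesis unfolding N_def bil_congruence' M_def bil_info_matrix[OF \<Delta>0] by (simp add: power2_eq_square)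
    qed
    have "n0 + 2 * n2 + n4 = bil N (axis 1 1) (axis 1 1) + 2 * bil N (axis 2 1) (axis 2 1) + bil N (axis 3 1) (axis 3 1)"
      unfolding bilN by (simp add: axis_def)
    also have "\<dots> = (\<Sum>y\<in>supp w. w y / (?S y)\<^sup>2 * ((axis 1 1 \<bullet> ?v y)\<^sup>2 + 2 * (axis 2 1 \<bullet> ?v y)\<^sup>2 + (axis 3 1 \<bullet> ?v y)\<^sup>2))"
      unfolding b by (simp add: sum.distrib sum_distrib_left algebra_simps add_divide_distrib)
    also have "\<dots> = (\<Sum>y\<in>supp w. w y)"
    proof (rule sum.cong)
      fix y
      have "(axis 1 1 \<bullet> ?v y)\<^sup>2 + 2 * (axis 2 1 \<bullet> ?v y)\<^sup>2 + (axis 3 1 \<bullet> ?v y)\<^sup>2 = (?S y)\<^sup>2"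
        unfolding inner_axis' veronese_def sqnorm_def by (simp, algebra)
      then show "w y / (?S y)\<^sup>2 * ((axis 1 1 \<bullet> ?v y)\<^sup>2 + 2 * (axis 2 1 \<bullet> ?v y)\<^sup>2 + (axis 3 1 \<bullet> ?v y)\<^sup>2) = w y"
        using sqnorm_hom_pos[OF \<Delta>0, of y] by simp
    qed simp
    also have "\<dots> = 1" using w by (simp add: design_def)
    finally show ?thesis .
  qed
  define A B E G where "A = n0 - n4" and "B = 2 * (n1 + n3)" and "E = n0 - 2 * n2 + n4" and "G = 2 * (n1 - n3)"
  \<comment> \<open>The vector represents \<open>-B cos 2\<theta> + A sin 2\<theta>\<close>. Its
    second moment is nonnegative and is exactly what the moments \<open>A\<close> and
    \<open>B\<close> subtract from the determinant.\<close>
  define T where "T = bil N (vector [- B, 2 * A, B]) (vector [- B, 2 * A, B])"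
  have T0: "T \<ge> 0" unfolding T_def by (rule nonneg)
  have T: "T = A\<^sup>2 * (1 - E) - 2 * A * B * G + B\<^sup>2 * E"
    unfolding T_def bilN using trace unfolding E_def G_def by (simp, algebra)
  \<comment> \<open>The factor 16 is the squared determinant of the change of basis from
    \<open>y^2, x y, x^2\<close> to \<open>1, cos 2\<theta>, sin 2\<theta>\<close>.\<close>
  have detN: "16 * det N = E * (1 - E) - G\<^sup>2 - T"
    unfolding T det_3 entries using trace unfolding A_def B_def E_def G_def by algebra
  have sq: "E * (1 - E) = 1/4 - (E - 1/2)\<^sup>2" by (simp add: power2_eq_square algebra_simps)
  have dN: "16 * det N = 1/4 - ((E - 1/2)\<^sup>2 + G\<^sup>2 + T)" using detN sq by simp
  have le: "det N \<le> 1/64" using dN T0 zero_le_power2[of "E - 1/2"] zero_le_power2[of G] by linarith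
  then show "(a0 * d0 - b0 * c0)^6 * det M \<le> 1/64" by (simp add: det)
  have "det N = 1/64 \<longleftrightarrow> (\<exists>\<kappa>>0. \<forall>x z. dual_form M x z = \<kappa> * (sqnorm a0 b0 c0 d0 x z)\<^sup>2)"
  proof
    assume "det N = 1/64"
    then have "(E - 1/2)\<^sup>2 + G\<^sup>2 + T = 0" using dN by simp
    then have "(E - 1/2)\<^sup>2 = 0" "G\<^sup>2 = 0" and T': "T = 0"
      using T0 zero_le_power2[of "E - 1/2"] zero_le_power2[of G] by linarith+
    then have EG: "E = 1/2" "G = 0" by simp_all
    have "A\<^sup>2 + B\<^sup>2 = 2 * T" unfolding T EG by simp
    then have "A\<^sup>2 + B\<^sup>2 = 0" using T' by simp
    then have AB: "A = 0" "B = 0" by (simp_all add: sum_power2_eq_zero_iff)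
    have n: "n1 = 0" "n3 = 0" "n0 = 3/8" "n4 = 3/8" "n2 = 1/8"
    proof -
      have "n0 = n4" "n1 + n3 = 0" "n1 - n3 = 0" "n0 - 2 * n2 + n4 = 1/2"
        using AB EG unfolding A_def B_def E_def G_def by simp_all
      then show "n1 = 0" "n3 = 0" "n0 = 3/8" "n4 = 3/8" "n2 = 1/8" using trace by linarith+
    qed
    have dN: "dual_form N x y = 3/8 * (x\<^sup>2 + y\<^sup>2)\<^sup>2" for x y
      unfolding dual_form_hankel[OF H] entries n by (simp add: power2_eq_square power4_eq_xxxx algebra_simps)
    have "(a0 * d0 - b0 * c0)^4 * dual_form M x z = 3/8 * (sqnorm a0 b0 c0 d0 x z)\<^sup>2" for x z
      using dual_form_congruence[of a0 b0 c0 d0 M x z, folded N_def] unfolding dN sqnorm_def by simp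
    then have "dual_form M x z = (3/8 / (a0 * d0 - b0 * c0)^4) * (sqnorm a0 b0 c0 d0 x z)\<^sup>2" for x z
      using \<Delta>0 by (metis (no_types, lifting) nonzero_eq_divide_eq mult.commute times_divide_eq_left power_not_zero)
    moreover have "3/8 / (a0 * d0 - b0 * c0)^4 > 0" using \<Delta>0 by simp
    ultimately show "\<exists>\<kappa>>0. \<forall>x z. dual_form M x z = \<kappa> * (sqnorm a0 b0 c0 d0 x z)\<^sup>2" by blast
  next
    assume "\<exists>\<kappa>>0. \<forall>x z. dual_form M x z = \<kappa> * (sqnorm a0 b0 c0 d0 x z)\<^sup>2"
    then obtain \<kappa> where \<kappa>: "\<kappa> > 0" "\<And>x z. dual_form M x z = \<kappa> * (sqnorm a0 b0 c0 d0 x z)\<^sup>2" by blast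
    define K where "K = (a0 * d0 - b0 * c0)^4 * \<kappa>"
    have "N = canon_mat K (1/3)" unfolding N_def K_def by (rule square_dual_form(1)[OF HM \<Delta>0 \<kappa>])
    then have n: "n0 = K" "n1 = 0" "n2 = K / 3" "n3 = 0" "n4 = K"
      by (simp_all add: n0_def n1_def n2_def n3_def n4_def canon_mat_def)
    then have K: "K = 3/8" using trace by simp
    show "det N = 1/64" unfolding det_3 entries n K by simp
  qed
  then show "(a0 * d0 - b0 * c0)^6 * det M = 1/64 \<longleftrightarrow>
      (\<exists>\<kappa>>0. \<forall>x z. dual_form M x z = \<kappa> * (sqnorm a0 b0 c0 d0 x z)\<^sup>2)" by (simp add: det)
qed

lemma D_optimal_iff:
  assumes \<Delta>0: "a0 * d0 - b0 * c0 \<noteq> 0"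
  shows "D_optimal (sigmaP2 a0 b0 c0 d0) w \<longleftrightarrow> design w \<and>
    (\<exists>\<kappa>>0. \<forall>x z. dual_form (info_matrix (sigmaP2 a0 b0 c0 d0) w) x z = \<kappa> * (sqnorm a0 b0 c0 d0 x z)\<^sup>2)"
proof -
  let ?M = "info_matrix (sigmaP2 a0 b0 c0 d0)" and ?D = "(a0 * d0 - b0 * c0)^6"
  have D: "?D > 0" using \<Delta>0 by (simp add: zero_less_power_eq)
  obtain v where v: "opt_design a0 b0 c0 d0 a0 b0 c0 d0 v" using ex_opt_design[OF \<Delta>0 \<Delta>0] by blast
  have vd: "design v" by (rule opt_design_design(1)[OF \<Delta>0 \<Delta>0 v])
  have v1: "?D * det (?M v) = 1/64"
    using det_information_bound(2)[OF \<Delta>0 vd] opt_design_dual_form[OF \<Delta>0 \<Delta>0 v] by blast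
  have "(\<forall>u. design u \<longrightarrow> det (?M u) \<le> det (?M w)) \<longleftrightarrow> ?D * det (?M w) = 1/64" if w: "design w"
  proof
    assume "\<forall>u. design u \<longrightarrow> det (?M u) \<le> det (?M w)"
    then have "?D * det (?M v) \<le> ?D * det (?M w)" using vd D by simp
    then show "?D * det (?M w) = 1/64" using v1 det_information_bound(1)[OF \<Delta>0 w] by simp
  next
    assume "?D * det (?M w) = 1/64"
    then show "\<forall>u. design u \<longrightarrow> det (?M u) \<le> det (?M w)"
      using det_information_bound(1)[OF \<Delta>0] D by (metis mult_le_cancel_left_pos)
  qed
  then show ?thesis unfolding D_optimal_def using det_information_bound(2)[OF \<Delta>0, of w] by blast
qed

section \<open>Moebius maps compared through their quadratic forms\<close>

lemma mobius_compose:
  assumes \<Delta>: "a * d - b * c \<noteq> 0" and \<Delta>': "p * t - q * r \<noteq> 0" and l: "l \<noteq> 0"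
  shows "mobius (l * (p * a + q * c)) (l * (p * b + q * d)) (l * (r * a + t * c)) (l * (r * b + t * d))
     = mobius p q r t \<circ> mobius a b c d"
proof
  fix y
  let ?z = "mobius a b c d y"
  have "(l * (p * a + q * c)) * (l * (r * b + t * d)) - (l * (p * b + q * d)) * (l * (r * a + t * c))
     = l\<^sup>2 * ((p * t - q * r) * (a * d - b * c))" by algebra
  then have n: "(l * (p * a + q * c)) * (l * (r * b + t * d)) - (l * (p * b + q * d)) * (l * (r * a + t * c)) \<noteq> 0"
    using assms by simp
  obtain e where e: "a * hom_x y + b * hom_y y = e * hom_x ?z" "c * hom_x y + d * hom_y y = e * hom_y ?z"
    using hom_mobius[OF \<Delta>] by blast
  obtain f where f: "p * hom_x ?z + q * hom_y ?z = f * hom_x (mobius p q r t ?z)"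
    "r * hom_x ?z + t * hom_y ?z = f * hom_y (mobius p q r t ?z)"
    using hom_mobius[OF \<Delta>'] by blast
  show "mobius (l * (p * a + q * c)) (l * (p * b + q * d)) (l * (r * a + t * c)) (l * (r * b + t * d)) y
     = (mobius p q r t \<circ> mobius a b c d) y"
    unfolding mobius_eq_iff[OF n] o_apply using e f by algebra
qed

text \<open>Equal Moebius maps have proportional coefficients, as comparison at infinity, 0 and 1
  shows. The form is quadratic in the coefficients, so its factor is a positive square.\<close>

lemma mobius_eq_sqnorm:
  assumes \<Delta>: "a * d - b * c \<noteq> 0" and \<Delta>': "a' * d' - b' * c' \<noteq> 0"
    and e: "mobius a b c d = mobius a' b' c' d'"
  shows "\<exists>l>0. \<forall>x z. sqnorm a b c d x z = l * sqnorm a' b' c' d' x z"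
proof -
  let ?D = "a' * d' - b' * c'"
  have cross: "(a * hom_x y + b * hom_y y) * (c' * hom_x y + d' * hom_y y)
     = (c * hom_x y + d * hom_y y) * (a' * hom_x y + b' * hom_y y)" for y
  proof -
    obtain f where "a' * hom_x y + b' * hom_y y = f * hom_x (mobius a b c d y)"
      "c' * hom_x y + d' * hom_y y = f * hom_y (mobius a b c d y)"
      unfolding e using hom_mobius[OF \<Delta>'] by blast
    moreover obtain g where "a * hom_x y + b * hom_y y = g * hom_x (mobius a b c d y)"
      "c * hom_x y + d * hom_y y = g * hom_y (mobius a b c d y)"
      using hom_mobius[OF \<Delta>] by blast
    ultimately show ?thesis by algebra
  qed
  have 1: "a * c' = c * a'" "b * d' = d * b'" using cross[of Infty] cross[of "Fin 0"] by simp_all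
  have "(a + b) * (c' + d') = (c + d) * (a' + b')" using cross[of "Fin 1"] by simp
  then have 2: "a * d' + b * c' = c * b' + d * a'" using 1 by (simp add: algebra_simps)
  define p where "p = a * d' - b * c'"
  have "?D * (c * d' - d * c') = 0" "?D * (b * a' - a * b') = 0" "?D * (p - (d * a' - c * b')) = 0"
    unfolding p_def using 1 2 by algebra+
  then have z: "c * d' = d * c'" "b * a' = a * b'" "p = d * a' - c * b'" using \<Delta>' by simp_all
  have scal: "?D * a = p * a'" "?D * b = p * b'" "?D * c = p * c'" "?D * d = p * d'"
    using z p_def 1 by algebra+
  have p0: "p \<noteq> 0"
  proof
    assume "p = 0"
    then have "a = 0" "b = 0" using scal \<Delta>' by simp_all
    then show False using \<Delta> by simp
  qed
  have lin: "u = p / ?D * u'" if "?D * u = p * u'" for u u'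
    using that \<Delta>' by (metis nonzero_eq_divide_eq mult.commute times_divide_eq_left)
  have "sqnorm a b c d x z = (p / ?D)\<^sup>2 * sqnorm a' b' c' d' x z" for x z
    unfolding lin[OF scal(1)] lin[OF scal(2)] lin[OF scal(3)] lin[OF scal(4)] sqnorm_def by algebra
  moreover have "(p / ?D)\<^sup>2 > 0" using p0 \<Delta>' by simp
  ultimately show ?thesis by blast
qed

text \<open>The transition matrix with rows \<open>(p, q)\<close> and \<open>(r, u)\<close>
  multiplies the Euclidean norm by a constant. It is thus a scaled rotation or reflection, and
  \<open>orient\<close> excludes reflections.\<close>

lemma sqnorm_proportional_mobius:
  assumes \<Delta>0: "a0 * d0 - b0 * c0 \<noteq> 0" and orient: "(a * d - b * c) * (a0 * d0 - b0 * c0) > 0"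
    and l: "l > 0" and e: "\<And>x z. sqnorm a b c d x z = l * sqnorm a0 b0 c0 d0 x z"
  shows "\<exists>s t. s\<^sup>2 + t\<^sup>2 = 1 \<and> mobius a b c d = mobius s (- t) t s \<circ> mobius a0 b0 c0 d0"
proof -
  let ?D = "a0 * d0 - b0 * c0"
  define p q r u where "p = (a * d0 - b * c0) / ?D" and "q = (b * a0 - a * b0) / ?D"
    and "r = (c * d0 - d * c0) / ?D" and "u = (d * a0 - c * b0) / ?D"
  have D: "?D * p = a * d0 - b * c0" "?D * q = b * a0 - a * b0" "?D * r = c * d0 - d * c0" "?D * u = d * a0 - c * b0"
    using \<Delta>0 by (simp_all add: p_def q_def r_def u_def)
  have "?D * (p * a0 + q * c0) = ?D * a" "?D * (p * b0 + q * d0) = ?D * b"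
    "?D * (r * a0 + u * c0) = ?D * c" "?D * (r * b0 + u * d0) = ?D * d"
    using D by algebra+
  then have comp: "p * a0 + q * c0 = a" "p * b0 + q * d0 = b" "r * a0 + u * c0 = c" "r * b0 + u * d0 = d"
    using \<Delta>0 by simp_all
  have norm: "(p * x + q * z)\<^sup>2 + (r * x + u * z)\<^sup>2 = l * (x\<^sup>2 + z\<^sup>2)" for x z
  proof -
    obtain x' z' where xz: "a0 * x' + b0 * z' = x" "c0 * x' + d0 * z' = z" using linear_system_solve[OF \<Delta>0] by blast
    have "a * x' + b * z' = p * x + q * z" "c * x' + d * z' = r * x + u * z"
      unfolding comp[symmetric] xz[symmetric] by (simp_all add: algebra_simps)
    then show ?thesis using e[of x' z'] unfolding sqnorm_def xz by simp
  qed
  have 1: "p\<^sup>2 + r\<^sup>2 = l" "q\<^sup>2 + u\<^sup>2 = l" using norm[of 1 0] norm[of 0 1] by simp_all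
  have 2: "p * q + r * u = 0" using norm[of 1 1] 1 by (simp add: power2_eq_square algebra_simps)
  have "(a * d - b * c) * ?D = (p * u - q * r) * ?D\<^sup>2" unfolding comp[symmetric] by algebra
  then have pos: "p * u - q * r > 0" using orient by (simp add: zero_less_mult_iff)
  have "(p * u - q * r)\<^sup>2 = (p\<^sup>2 + r\<^sup>2) * (q\<^sup>2 + u\<^sup>2) - (p * q + r * u)\<^sup>2" by algebra
  then have "(p * u - q * r)\<^sup>2 = l\<^sup>2" unfolding 1 2 by (simp add: power2_eq_square)
  then have dl: "p * u - q * r = l" using pos l by (simp add: power2_eq_iff)
  have "(u - p)\<^sup>2 + (q + r)\<^sup>2 = 0" using 1 dl by (simp add: power2_eq_square algebra_simps)
  then have "u - p = 0" "q + r = 0" by (simp_all only: sum_power2_eq_zero_iff)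
  then have uq: "u = p" "q = - r" by simp_all
  define m s t where "m = sqrt l" and "s = p / m" and "t = r / m"
  have m: "m > 0" "m\<^sup>2 = l" using l by (simp_all add: m_def)
  have st: "s\<^sup>2 + t\<^sup>2 = 1" using 1(1) m l
    by (simp add: s_def t_def power_divide add_divide_distrib[symmetric])
  have pm: "p = m * s" "r = m * t" using m by (simp_all add: s_def t_def)
  have "mobius (m * (s * a0 + - t * c0)) (m * (s * b0 + - t * d0)) (m * (t * a0 + s * c0)) (m * (t * b0 + s * d0))
     = mobius s (- t) t s \<circ> mobius a0 b0 c0 d0"
    by (rule mobius_compose[OF \<Delta>0]) (use st m in \<open>simp_all add: power2_eq_square\<close>)
  moreover have "m * (s * a0 + - t * c0) = a" "m * (s * b0 + - t * d0) = b"
    "m * (t * a0 + s * c0) = c" "m * (t * b0 + s * d0) = d"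
    unfolding comp[symmetric] uq pm by (simp_all add: algebra_simps)
  ultimately show ?thesis using st by metis
qed

lemma rotation_mobius_sqnorm:
  assumes \<Delta>0: "a0 * d0 - b0 * c0 \<noteq> 0" and \<Delta>: "a * d - b * c \<noteq> 0" and st: "s\<^sup>2 + t\<^sup>2 = 1"
    and e: "mobius a b c d = mobius s (- t) t s \<circ> mobius a0 b0 c0 d0"
  shows "\<exists>l>0. \<forall>x z. sqnorm a b c d x z = l * sqnorm a0 b0 c0 d0 x z"
proof -
  have n: "s * s - (- t) * t \<noteq> 0" using st by (simp add: power2_eq_square)
  \<comment> \<open>The factors 1 match the scalar \<open>l\<close> of
    \<open>mobius_compose\<close>.\<close>
  have "(1 * (s * a0 + - t * c0)) * (1 * (t * b0 + s * d0)) - (1 * (s * b0 + - t * d0)) * (1 * (t * a0 + s * c0))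
     = a0 * d0 - b0 * c0" using st by algebra
  then have n': "(1 * (s * a0 + - t * c0)) * (1 * (t * b0 + s * d0)) - (1 * (s * b0 + - t * d0)) * (1 * (t * a0 + s * c0)) \<noteq> 0"
    using \<Delta>0 by simp
  have "mobius a b c d = mobius (1 * (s * a0 + - t * c0)) (1 * (s * b0 + - t * d0)) (1 * (t * a0 + s * c0)) (1 * (t * b0 + s * d0))"
    unfolding e by (rule mobius_compose[OF \<Delta>0 n, symmetric]) simp
  from mobius_eq_sqnorm[OF \<Delta> n' this]
  obtain l where l: "l > 0" "\<And>x z. sqnorm a b c d x z = l * sqnorm (1 * (s * a0 + - t * c0)) (1 * (s * b0 + - t * d0))
      (1 * (t * a0 + s * c0)) (1 * (t * b0 + s * d0)) x z" by blast
  moreover have "sqnorm (1 * (s * a0 + - t * c0)) (1 * (s * b0 + - t * d0)) (1 * (t * a0 + s * c0)) (1 * (t * b0 + s * d0)) x z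
     = sqnorm a0 b0 c0 d0 x z" for x z
    unfolding sqnorm_def using st by algebra
  ultimately show ?thesis by auto
qed

lemma D_optimal_three_point:
  assumes \<Delta>0: "a0 * d0 - b0 * c0 \<noteq> 0"
  shows "{w. three_point w \<and> D_optimal (sigmaP2 a0 b0 c0 d0) w}
     = {w. \<exists>a b c d. a * d - b * c \<noteq> 0 \<and>
             (\<exists>s t. s\<^sup>2 + t\<^sup>2 = 1 \<and> mobius a b c d = mobius s (- t) t s \<circ> mobius a0 b0 c0 d0) \<and>
             opt_design a0 b0 c0 d0 a b c d w}" (is "?L = ?R")
proof (intro equalityI subsetI)
  let ?M = "info_matrix (sigmaP2 a0 b0 c0 d0)"
  fix w assume "w \<in> ?L"
  then have w3: "three_point w" and wd: "design w"
    and "\<exists>\<kappa>>0. \<forall>x z. dual_form (?M w) x z = \<kappa> * (sqnorm a0 b0 c0 d0 x z)\<^sup>2"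
    using D_optimal_iff[OF \<Delta>0] by auto
  then obtain \<kappa> where \<kappa>: "\<kappa> > 0" "\<And>x z. dual_form (?M w) x z = \<kappa> * (sqnorm a0 b0 c0 d0 x z)\<^sup>2" by blast
  \<comment> \<open>The sign is taken from the given determinant, so that the transition from
    \<open>a0, b0, c0, d0\<close> is a rotation up to scale.\<close>
  obtain a b c d where orient: "(a * d - b * c) * (a0 * d0 - b0 * c0) > 0" and o: "opt_design a0 b0 c0 d0 a b c d w"
    using three_point_opt_design[OF \<Delta>0 wd w3 \<kappa> \<Delta>0] by blast
  then have \<Delta>: "a * d - b * c \<noteq> 0" by auto
  obtain K where K: "K > 0" "\<And>x z. dual_form (?M w) x z = K * (sqnorm a b c d x z)\<^sup>2"
    using opt_design_dual_form[OF \<Delta>0 \<Delta> o] by blast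
  have nn: "sqnorm p q r t x z \<ge> 0" for p q r t x z by (simp add: sqnorm_def)
  have "sqnorm a b c d x z = sqrt (\<kappa> / K) * sqnorm a0 b0 c0 d0 x z" for x z
  proof -
    have "K * (sqnorm a b c d x z)\<^sup>2 = \<kappa> * (sqnorm a0 b0 c0 d0 x z)\<^sup>2" using K \<kappa> by metis
    then have "(sqnorm a b c d x z)\<^sup>2 = \<kappa> / K * (sqnorm a0 b0 c0 d0 x z)\<^sup>2" using K(1) by (simp add: field_simps)
    then have "sqrt ((sqnorm a b c d x z)\<^sup>2) = sqrt (\<kappa> / K) * sqrt ((sqnorm a0 b0 c0 d0 x z)\<^sup>2)"
      by (simp only: real_sqrt_mult)
    then show ?thesis using nn by simp
  qed
  then have "\<exists>s t. s\<^sup>2 + t\<^sup>2 = 1 \<and> mobius a b c d = mobius s (- t) t s \<circ> mobius a0 b0 c0 d0"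
    using sqnorm_proportional_mobius[OF \<Delta>0 orient, of "sqrt (\<kappa> / K)"] \<kappa>(1) K(1) by simp
  then show "w \<in> ?R" using \<Delta> o by blast
next
  let ?M = "info_matrix (sigmaP2 a0 b0 c0 d0)"
  fix w assume "w \<in> ?R"
  then obtain a b c d s t where \<Delta>: "a * d - b * c \<noteq> 0" and st: "s\<^sup>2 + t\<^sup>2 = 1"
    and m: "mobius a b c d = mobius s (- t) t s \<circ> mobius a0 b0 c0 d0"
    and o: "opt_design a0 b0 c0 d0 a b c d w" by blast
  obtain l where l: "l > 0" "\<And>x z. sqnorm a b c d x z = l * sqnorm a0 b0 c0 d0 x z"
    using rotation_mobius_sqnorm[OF \<Delta>0 \<Delta> st m] by blast
  obtain K where K: "K > 0" "\<And>x z. dual_form (?M w) x z = K * (sqnorm a b c d x z)\<^sup>2"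
    using opt_design_dual_form[OF \<Delta>0 \<Delta> o] by blast
  have "K * l\<^sup>2 > 0" "\<And>x z. dual_form (?M w) x z = (K * l\<^sup>2) * (sqnorm a0 b0 c0 d0 x z)\<^sup>2"
    using K l by (simp_all add: power_mult_distrib)
  then show "w \<in> ?L" using opt_design_design[OF \<Delta>0 \<Delta> o] D_optimal_iff[OF \<Delta>0] by blast
qed

theorem theorem4p9:
  fixes a0 b0 c0 d0 :: real
  assumes "a0 * d0 - b0 * c0 \<noteq> 0"
  shows "(\<forall>a b c d. a * d - b * c \<noteq> 0 \<longrightarrow>
            (\<exists>!k. k > 0 \<and>
               (\<Sum>i=1..3. k * var_ratio a0 b0 c0 d0 a b c d (opt_point a b c d i)) = 1))
       \<and> {w. three_point w \<and> tube_volume_optimal (sigmaP2 a0 b0 c0 d0) w}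
         = {w. \<exists>a b c d. a * d - b * c \<noteq> 0 \<and> opt_design a0 b0 c0 d0 a b c d w}
       \<and> {w. three_point w \<and> D_optimal (sigmaP2 a0 b0 c0 d0) w}
         = {w. \<exists>a b c d. a * d - b * c \<noteq> 0 \<and>
                 (\<exists>s t. s\<^sup>2 + t\<^sup>2 = 1 \<and>
                    mobius a b c d = mobius s (- t) t s \<circ> mobius a0 b0 c0 d0) \<and>
                 opt_design a0 b0 c0 d0 a b c d w}"
  by (intro conjI allI impI ex1_normalising_constant[OF assms] tube_volume_optimal_three_point[OF assms]
      D_optimal_three_point[OF assms])

end
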